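(* Let $p,q\in(0,\infty)$, let $\phi$ be a normal function on $[0,1)$, let $\mu$ be a weight, let $n\in\mathbb{N}_0$, let $g\in H(\mathbb{D})$, and let $\varphi$ be an analytic self-map of $\mathbb{D}$. If the operator $C_{\varphi,g}^n : H(p,q,\phi)\to\mathcal{B}_\mu$ is bounded, then $$\|C_{\varphi,g}^n\|_{e,\,H(p,q,\phi)\to\mathcal{B}_\mu}\approx \limsup_{|\varphi(z)|\to 1}\frac{\mu(|z|)\,|g(z)|}{\phi(|\varphi(z)|)(1-|\varphi(z)|^2)^{1/q+n}}.$$ Here $X\approx Y$ means that there are constants $C_1,C_2>0$, depending only on $p,q,\phi,n$, such that $C_1Y\le X\le C_2Y$.
   Context: $\mathbb{D}$ is the open unit disc in $\mathbb{C}$, $H(\mathbb{D})$ is the space of analytic functions on $\mathbb{D}$, and an analytic self-map of $\mathbb{D}$ is an analytic function $\varphi:\mathbb{D}\to\mathbb{D}$. Normal function: a positive continuous function $\phi$ on $[0,1)$ for which there are constants $b>a>0$ such that $\phi(r)/(1-r)^a$ is non-increasing on $[0,1)$ and tends to $0$ as $r\to1^-$, and $\phi(r)/(1-r)^b$ is non-decreasing on $[0,1)$ and tends to $\infty$ as $r\to1^-$. Mixed-norm space: for $0<p,q<\infty$ and $\phi$ normal, $H(p,q,\phi)$ is the space of all $f\in H(\mathbb{D})$ with $$\|f\|_{p,q,\phi}^p=\int_0^1 M_q^p(f,r)\frac{\phi^p(r)}{1-r}\,dr<\infty,\qquad M_q(f,r)=\left(\frac1{2\pi}\int_0^{2\pi}|f(re^{i\theta})|^q\,d\theta\right)^{1/q}.$$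 (In general $\|\cdot\|_{p,q,\phi}$ is only a quasi-norm.) Weight: a positive continuous function $\mu$ on $\mathbb{D}$ (only the values $\mu(|z|)$ are used). Weighted Bloch space: $\mathcal{B}_\mu$ is the space of $f\in H(\mathbb{D})$ with $\|f\|_{\mathcal{B}_\mu}=|f(0)|+\sup_{z\in\mathbb{D}}\mu(|z|)|f'(z)|<\infty$. Generalized integration operator: for $n\in\mathbb{N}_0=\{0,1,2,\dots\}$, $(C_{\varphi,g}^nf)(z)=\int_0^z f^{(n)}(\varphi(\xi))g(\xi)\,d\xi$ for $f\in H(\mathbb{D})$, $z\in\mathbb{D}$. For a linear operator $T:X\to Y$, $\|T\|=\sup_{\|f\|_X\le1}\|Tf\|_Y$; $T$ is bounded if $\|T\|<\infty$ and compact if it maps bounded sets to relatively compact sets. The essential norm is $\|T\|_{e,X\to Y}=\inf\{\|T-S\|: S \text{ is a compact linear operator from } X \text{ to } Y\}$. $\limsup_{|\varphi(z)|\to1}F(z)$ means $\lim_{\delta\to1^-}\sup\{F(z): z\in\mathbb{D},\ \delta<|\varphi(z)|<1\}$ for nonnegative $F$, with the supremum over the empty set equal to $0$ (so the limsup is $0$ if $\sup_{z\in\mathbb{D}}|\varphi(z)|<1$). *)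

theory Defs
  imports "HOL-Complex_Analysis.Complex_Analysis"
begin

abbreviation disc :: "complex set" where
  "disc \<equiv> ball 0 1"

text \<open>
  Elements of $H(D)$ are represented by functions on the whole plane that vanish off the disc.
  Fixing the values off the disc makes equality of representatives equality in $H(D)$,
  so that operators, linearity and norms are well defined on representatives.
\<close>

definition holo_disc :: "(complex \<Rightarrow> complex) set" where
  "holo_disc = {f. f holomorphic_on disc \<and> (\<forall>z. z \<notin> disc \<longrightarrow> f z = 0)}"

definition self_map :: "(complex \<Rightarrow> complex) \<Rightarrow> bool" where
  "self_map \<psi> \<longleftrightarrow> \<psi> holomorphic_on disc \<and> \<psi> ` disc \<subseteq> disc"

definition normal_function :: "(real \<Rightarrow> real) \<Rightarrow> bool" where
  "normal_function \<phi> \<longleftrightarrow>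
     continuous_on {0..<1} \<phi> \<and> (\<forall>r\<in>{0..<1}. 0 < \<phi> r) \<and>
     (\<exists>a b. 0 < a \<and> a < b \<and>
        antimono_on {0..<1} (\<lambda>r. \<phi> r / (1 - r) powr a) \<and>
        ((\<lambda>r. \<phi> r / (1 - r) powr a) \<longlongrightarrow> 0) (at_left 1) \<and>
        mono_on {0..<1} (\<lambda>r. \<phi> r / (1 - r) powr b) \<and>
        filterlim (\<lambda>r. \<phi> r / (1 - r) powr b) at_top (at_left 1))"

definition weight :: "(complex \<Rightarrow> real) \<Rightarrow> bool" where
  "weight \<mu> \<longleftrightarrow> continuous_on disc \<mu> \<and> (\<forall>z\<in>disc. 0 < \<mu> z)"


text \<open>
  (Quasi-)norms take values in the extended nonnegative reals, being infinite
  exactly at the members of \<^const>\<open>holo_disc\<close> outside the space in question.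
\<close>

definition integral_mean :: "real \<Rightarrow> (complex \<Rightarrow> complex) \<Rightarrow> real \<Rightarrow> real" where
  "integral_mean q f r =
     (1 / (2 * pi) * integral {0..2 * pi} (\<lambda>\<theta>. cmod (f (rcis r \<theta>)) powr q)) powr (1 / q)"

definition mixed_norm :: "real \<Rightarrow> real \<Rightarrow> (real \<Rightarrow> real) \<Rightarrow> (complex \<Rightarrow> complex) \<Rightarrow> ennreal" where
  "mixed_norm p q \<phi> f =
     (let I = \<integral>\<^sup>+ r\<in>{0..<1}. ennreal (integral_mean q f r powr p * (\<phi> r powr p / (1 - r))) \<partial>lborel
      in if I = \<infinity> then \<infinity> else ennreal (enn2real I powr (1 / p)))"

definition mixed_space :: "real \<Rightarrow> real \<Rightarrow> (real \<Rightarrow> real) \<Rightarrow> (complex \<Rightarrow> complex) set" where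
  "mixed_space p q \<phi> = {f \<in> holo_disc. mixed_norm p q \<phi> f < \<infinity>}"

definition bloch_norm :: "(complex \<Rightarrow> real) \<Rightarrow> (complex \<Rightarrow> complex) \<Rightarrow> ennreal" where
  "bloch_norm \<mu> f =
     ennreal (cmod (f 0)) + (SUP z\<in>disc. ennreal (\<mu> (of_real (cmod z)) * cmod (deriv f z)))"

definition bloch_space :: "(complex \<Rightarrow> real) \<Rightarrow> (complex \<Rightarrow> complex) set" where
  "bloch_space \<mu> = {f \<in> holo_disc. bloch_norm \<mu> f < \<infinity>}"


definition linear_operator ::
  "(complex \<Rightarrow> complex) set \<Rightarrow> (complex \<Rightarrow> complex) set \<Rightarrow>
   ((complex \<Rightarrow> complex) \<Rightarrow> (complex \<Rightarrow> complex)) \<Rightarrow> bool" where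
  "linear_operator X Y T \<longleftrightarrow>
     T ` X \<subseteq> Y \<and>
     (\<forall>f\<in>X. \<forall>h\<in>X. T (\<lambda>z. f z + h z) = (\<lambda>z. T f z + T h z)) \<and>
     (\<forall>c. \<forall>f\<in>X. T (\<lambda>z. c * f z) = (\<lambda>z. c * T f z))"

definition op_norm ::
  "(complex \<Rightarrow> complex) set \<Rightarrow> ((complex \<Rightarrow> complex) \<Rightarrow> ennreal) \<Rightarrow>
   ((complex \<Rightarrow> complex) \<Rightarrow> ennreal) \<Rightarrow>
   ((complex \<Rightarrow> complex) \<Rightarrow> (complex \<Rightarrow> complex)) \<Rightarrow> ennreal" where
  "op_norm X nX nY T = (SUP f\<in>{f \<in> X. nX f \<le> 1}. nY (T f))"

definition bounded_operator ::
  "(complex \<Rightarrow> complex) set \<Rightarrow> ((complex \<Rightarrow> complex) \<Rightarrow> ennreal) \<Rightarrow>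
   (complex \<Rightarrow> complex) set \<Rightarrow> ((complex \<Rightarrow> complex) \<Rightarrow> ennreal) \<Rightarrow>
   ((complex \<Rightarrow> complex) \<Rightarrow> (complex \<Rightarrow> complex)) \<Rightarrow> bool" where
  "bounded_operator X nX Y nY T \<longleftrightarrow> linear_operator X Y T \<and> op_norm X nX nY T < \<infinity>"

definition norm_topology ::
  "(complex \<Rightarrow> complex) set \<Rightarrow> ((complex \<Rightarrow> complex) \<Rightarrow> ennreal) \<Rightarrow> (complex \<Rightarrow> complex) topology" where
  "norm_topology Y nY = Metric_space.mtopology Y (\<lambda>f h. enn2real (nY (\<lambda>z. f z - h z)))"

definition compact_operator ::
  "(complex \<Rightarrow> complex) set \<Rightarrow> ((complex \<Rightarrow> complex) \<Rightarrow> ennreal) \<Rightarrow>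
   (complex \<Rightarrow> complex) set \<Rightarrow> ((complex \<Rightarrow> complex) \<Rightarrow> ennreal) \<Rightarrow>
   ((complex \<Rightarrow> complex) \<Rightarrow> (complex \<Rightarrow> complex)) \<Rightarrow> bool" where
  "compact_operator X nX Y nY T \<longleftrightarrow>
     linear_operator X Y T \<and>
     (\<forall>B K. B \<subseteq> X \<longrightarrow> (\<forall>f\<in>B. nX f \<le> ennreal K) \<longrightarrow>
        compactin (norm_topology Y nY) (norm_topology Y nY closure_of (T ` B)))"

definition essential_norm ::
  "(complex \<Rightarrow> complex) set \<Rightarrow> ((complex \<Rightarrow> complex) \<Rightarrow> ennreal) \<Rightarrow>
   (complex \<Rightarrow> complex) set \<Rightarrow> ((complex \<Rightarrow> complex) \<Rightarrow> ennreal) \<Rightarrow>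
   ((complex \<Rightarrow> complex) \<Rightarrow> (complex \<Rightarrow> complex)) \<Rightarrow> ennreal" where
  "essential_norm X nX Y nY T =
     (INF S\<in>{S. compact_operator X nX Y nY S}. op_norm X nX nY (\<lambda>f z. T f z - S f z))"


definition integration_operator ::
  "nat \<Rightarrow> (complex \<Rightarrow> complex) \<Rightarrow> (complex \<Rightarrow> complex) \<Rightarrow> (complex \<Rightarrow> complex) \<Rightarrow> (complex \<Rightarrow> complex)" where
  "integration_operator n \<psi> g f =
     (\<lambda>z. if z \<in> disc
          then contour_integral (linepath 0 z) (\<lambda>\<xi>. (deriv ^^ n) f (\<psi> \<xi>) * g \<xi>)
          else 0)"

text \<open>
  The supremum of the empty set of extended nonnegative reals is 0, so this is 0 when the
  range of \<open>\<psi>\<close> stays away from the unit circle.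
\<close>

definition boundary_limsup :: "(complex \<Rightarrow> complex) \<Rightarrow> (complex \<Rightarrow> real) \<Rightarrow> ennreal" where
  "boundary_limsup \<psi> F =
     Lim (at_left (1::real))
       (\<lambda>\<delta>. SUP z\<in>{z \<in> disc. \<delta> < cmod (\<psi> z) \<and> cmod (\<psi> z) < 1}. ennreal (F z))"


text \<open>
  The metric underlying \<^const>\<open>norm_topology\<close> is a genuine one on the weighted Bloch space, so
  the results of the locale \<^locale>\<open>Metric_space\<close> apply to its topology.
\<close>

lemma cmod_deriv_uminus: "cmod (deriv (\<lambda>z. - u z) z) = cmod (deriv u z)"
proof (cases "u field_differentiable at z")
  case True
  then show ?thesis by (simp add: deriv_minus)
next
  case False
  then have 1: "\<And>D. \<not> (u has_field_derivative D) (at z)"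
    by (auto simp: field_differentiable_def)
  have 2: "\<not> ((\<lambda>z. - u z) has_field_derivative D) (at z)" for D
    using 1[of "- D"] DERIV_minus[of "\<lambda>z. - u z" D z] by auto
  show ?thesis by (simp add: deriv_def 1 2)
qed

lemma bloch_norm_triangle:
  assumes "weight \<mu>" "u holomorphic_on disc" "v holomorphic_on disc"
  shows "bloch_norm \<mu> (\<lambda>z. u z + v z) \<le> bloch_norm \<mu> u + bloch_norm \<mu> v"
proof -
  let ?s = "\<lambda>w z. ennreal (\<mu> (of_real (cmod z)) * cmod (deriv w z))"
  have "?s (\<lambda>z. u z + v z) z \<le> (SUP z\<in>disc. ?s u z) + (SUP z\<in>disc. ?s v z)" if z: "z \<in> disc" for z
  proof -
    have m: "0 < \<mu> (of_real (cmod z))" using assms(1) z by (auto simp: weight_def)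
    have "u field_differentiable at z" "v field_differentiable at z"
      using assms z by (auto intro: holomorphic_on_imp_differentiable_at)
    then have "?s (\<lambda>z. u z + v z) z
        \<le> ennreal (\<mu> (of_real (cmod z)) * cmod (deriv u z) + \<mu> (of_real (cmod z)) * cmod (deriv v z))"
      using m by (intro ennreal_leI)
        (auto simp: distrib_left[symmetric] intro!: mult_left_mono norm_triangle_ineq)
    also have "\<dots> = ?s u z + ?s v z" using m by (simp add: ennreal_plus)
    also have "\<dots> \<le> (SUP z\<in>disc. ?s u z) + (SUP z\<in>disc. ?s v z)"
      using z by (intro add_mono SUP_upper)
    finally show ?thesis .
  qed
  then have S: "(SUP z\<in>disc. ?s (\<lambda>z. u z + v z) z) \<le> (SUP z\<in>disc. ?s u z) + (SUP z\<in>disc. ?s v z)"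
    by (rule SUP_least)
  have "ennreal (cmod (u 0 + v 0)) \<le> ennreal (cmod (u 0)) + ennreal (cmod (v 0))"
    by (simp add: ennreal_plus[symmetric] norm_triangle_ineq del: ennreal_plus)
  from add_mono[OF this S] show ?thesis
    by (simp add: bloch_norm_def ac_simps)
qed

lemma bloch_norm_uminus: "bloch_norm \<mu> (\<lambda>z. - u z) = bloch_norm \<mu> u"
  by (simp add: bloch_norm_def cmod_deriv_uminus)

lemma Metric_space_bloch:
  assumes "weight \<mu>"
  shows "Metric_space (bloch_space \<mu>) (\<lambda>f h. enn2real (bloch_norm \<mu> (\<lambda>z. f z - h z)))"
proof
  fix x y show "0 \<le> enn2real (bloch_norm \<mu> (\<lambda>z. x z - y z))" by simp
  show "enn2real (bloch_norm \<mu> (\<lambda>z. x z - y z)) = enn2real (bloch_norm \<mu> (\<lambda>z. y z - x z))"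
    using bloch_norm_uminus[of \<mu> "\<lambda>z. x z - y z"] by simp
next
  have fin: "bloch_norm \<mu> (\<lambda>z. x z - y z) < \<infinity>" if "x \<in> bloch_space \<mu>" "y \<in> bloch_space \<mu>" for x y
  proof -
    have "bloch_norm \<mu> (\<lambda>z. x z + - y z) \<le> bloch_norm \<mu> x + bloch_norm \<mu> (\<lambda>z. - y z)"
      using that by (intro bloch_norm_triangle assms)
        (auto simp: bloch_space_def holo_disc_def intro!: holomorphic_intros)
    also have "\<dots> < \<infinity>" using that by (simp add: bloch_norm_uminus bloch_space_def)
    finally show ?thesis by simp
  qed
  {
    fix x y assume xy: "x \<in> bloch_space \<mu>" "y \<in> bloch_space \<mu>"
    show "enn2real (bloch_norm \<mu> (\<lambda>z. x z - y z)) = 0 \<longleftrightarrow> x = y"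
    proof
      assume "enn2real (bloch_norm \<mu> (\<lambda>z. x z - y z)) = 0"
      then have 0: "bloch_norm \<mu> (\<lambda>z. x z - y z) = 0"
        using fin[OF xy] by (auto simp: enn2real_eq_0_iff)
      then have x0: "x 0 - y 0 = 0" by (simp add: bloch_norm_def)
      have d0: "deriv (\<lambda>z. x z - y z) z = 0" if z: "z \<in> disc" for z
      proof -
        have "(SUP z\<in>disc. ennreal (\<mu> (of_real (cmod z)) * cmod (deriv (\<lambda>z. x z - y z) z))) = 0"
          using 0 by (simp add: bloch_norm_def)
        then have "ennreal (\<mu> (of_real (cmod z)) * cmod (deriv (\<lambda>z. x z - y z) z)) \<le> 0"
          using SUP_upper[OF z, of "\<lambda>z. ennreal (\<mu> (of_real (cmod z)) * cmod (deriv (\<lambda>z. x z - y z) z))"]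
          by simp
        moreover have "0 < \<mu> (of_real (cmod z))" using assms z by (auto simp: weight_def)
        ultimately show ?thesis by (simp add: ennreal_eq_0_iff mult_le_0_iff)
      qed
      have hol: "(\<lambda>z. x z - y z) holomorphic_on disc"
        using xy by (auto simp: bloch_space_def holo_disc_def intro!: holomorphic_intros)
      have "x z - y z = 0" if z: "z \<in> disc" for z
      proof -
        have "((\<lambda>z. x z - y z) has_field_derivative 0) (at w within disc)" if "w \<in> disc" for w
          using holomorphic_derivI[OF hol open_ball that] d0[OF that]
          by metis
        then have "\<exists>c. \<forall>w\<in>disc. x w - y w = c"
          by (intro has_field_derivative_zero_constant) auto
        then obtain c where c: "\<And>w. w \<in> disc \<Longrightarrow> x w - y w = c" by blast
        show ?thesis using c[OF z] c[of 0] x0 by simp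
      qed
      moreover have "x z = y z" if "z \<notin> disc" for z
        using xy that by (simp add: bloch_space_def holo_disc_def)
      ultimately show "x = y" by (intro ext) (metis right_minus_eq)
    qed (simp add: bloch_norm_def)
  }
  fix x y z assume xyz: "x \<in> bloch_space \<mu>" "y \<in> bloch_space \<mu>" "z \<in> bloch_space \<mu>"
  have "bloch_norm \<mu> (\<lambda>w. (x w - y w) + (y w - z w))
      \<le> bloch_norm \<mu> (\<lambda>w. x w - y w) + bloch_norm \<mu> (\<lambda>w. y w - z w)"
    using xyz by (intro bloch_norm_triangle assms)
      (auto simp: bloch_space_def holo_disc_def intro!: holomorphic_intros)
  then have "enn2real (bloch_norm \<mu> (\<lambda>w. x w - z w))
      \<le> enn2real (bloch_norm \<mu> (\<lambda>w. x w - y w) + bloch_norm \<mu> (\<lambda>w. y w - z w))"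
    using fin[OF xyz(1,2)] fin[OF xyz(2,3)] by (intro enn2real_mono) auto
  then show "enn2real (bloch_norm \<mu> (\<lambda>w. x w - z w))
      \<le> enn2real (bloch_norm \<mu> (\<lambda>w. x w - y w)) + enn2real (bloch_norm \<mu> (\<lambda>w. y w - z w))"
    using fin[OF xyz(1,2)] fin[OF xyz(2,3)] by (simp add: enn2real_plus)
qed

end

theory Submission
  imports Defs "HOL-Computational_Algebra.Fundamental_Theorem_Algebra"
begin

text \<open>
  Upper bound: with \<open>T\<close> the operator for \<open>\<psi>\<close>, the operators for \<open>r \<psi>\<close> (\<open>r < 1\<close>) are compact by Montel's
  theorem. Where \<open>\<bar>\<psi>\<bar> \<le> \<delta>\<close> they are close to \<open>T\<close> for \<open>r\<close> near 1;
  where \<open>\<bar>\<psi>\<bar> > \<delta>\<close> both are controlled by the growth estimate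
   \<open>\<bar>(deriv ^^ n) f w\<bar> * \<phi> \<bar>w\<bar> * (1 - \<bar>w\<bar>\<^sup>2) powr (1/q + n) \<le> C * \<parallel>f\<parallel>\<close>,
  which comes from a mean value inequality for \<open>\<bar>f\<bar> powr q\<close> integrated over radii between \<open>\<bar>w\<bar>\<close> and 1.

  Lower bound: the functions \<open>(1 - \<bar>w\<bar>\<^sup>2) powr (N - 1/q) / (\<phi> \<bar>w\<bar> * (1 - cnj w * z) ^ N)\<close> of \<open>z\<close>, with
  \<open>N\<close> a large integer, are bounded in the mixed norm space, tend to 0 locally uniformly as \<open>\<bar>w\<bar>\<close> tends
  to 1, and attain the growth estimate at \<open>w\<close> up to a constant.
  A compact \<open>S\<close> maps them to a relatively compact set, so \<open>T - S\<close> is large on the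
  difference of two of them.
\<close>

section \<open>A mean value inequality for powers of the modulus\<close>

text \<open>The constants may not depend on \<open>\<mu>\<close>, \<open>g\<close> or
  \<open>\<psi>\<close>, so the estimates in the mixed norm are proved before these are fixed. The
  mean value inequality on the circle of radius \<open>R\<close> carries the factor
  \<open>1 - cmod w / R\<close>. Taking \<open>1 - R\<close> comparable to \<open>1 - cmod w\<close>
  turns it into the power \<open>1 / q\<close> of the growth estimate. Closeness of the two
  operators where \<psi> stays in a smaller disc is uniform over the unit ball because the growth
  estimate is available for the derivative of order \<open>n + 1\<close> as well. Montel's theorem
  is applied to the \<open>n\<close>-th derivatives themselves, since the operator sees
  \<open>f\<close> only through them.\<close>

lemma Cauchy_mean_bound:
  assumes cont: "continuous_on (cball 0 1) h" and holo: "h holomorphic_on ball 0 1"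
    and w: "cmod w < 1"
  shows "cmod (h w) * (1 - cmod w) * (2 * pi) \<le> integral {0..2 * pi} (\<lambda>t. cmod (h (cis t)))"
proof -
  define k where "k = (\<lambda>t. h (cis t) / (cis t - w) * (\<i> * cis t))"
  have ne: "cis t - w \<noteq> 0" for t
    using w by (metis eq_iff_diff_eq_0 less_irrefl norm_cis)
  have ch: "continuous_on {0..2 * pi} (\<lambda>t. h (cis t))"
    by (intro continuous_on_compose2[OF cont] continuous_intros) (auto intro!: continuous_intros)
  have "((\<lambda>u. h u / (u - w)) has_contour_integral (2 * of_real pi * \<i> * h w)) (circlepath 0 1)"
    by (intro Cauchy_integral_circlepath cont) (use holo w in auto)
  then have "((\<lambda>u. h u / (u - w)) has_contour_integral (2 * of_real pi * \<i> * h w))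
      (part_circlepath 0 1 0 (2 * pi))"
    by (simp add: circlepath_def)
  then have I: "(k has_integral (2 * of_real pi * \<i> * h w)) {0..2 * pi}"
    by (subst (asm) has_contour_integral_part_circlepath_iff) (simp_all add: k_def mult_ac)
  \<comment> \<open>On the unit circle the Cauchy kernel at \<open>w\<close> is at most
    \<open>1 / (1 - cmod w)\<close>. This has the same order as the maximum of the Poisson kernel,
    so nothing essential is lost.\<close>
  have bound: "cmod (k t) \<le> cmod (h (cis t)) / (1 - cmod w)" for t
  proof -
    have "1 - cmod w \<le> cmod (cis t - w)"
      using norm_triangle_ineq2[of "cis t" w] by simp
    then show ?thesis
      using w by (auto simp: k_def norm_mult norm_divide intro!: divide_left_mono mult_pos_pos simp: ne)
  qed
  have "continuous_on {0..2 * pi} k"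
    unfolding k_def by (intro continuous_intros ch) (use ne in auto)
  then have ik: "k integrable_on {0..2 * pi}"
    by (rule integrable_continuous_real)
  have "cmod (integral {0..2 * pi} k) \<le> integral {0..2 * pi} (\<lambda>t. cmod (h (cis t)) / (1 - cmod w))"
    by (rule integral_norm_bound_integral)
      (use ik bound ch w in \<open>auto intro!: integrable_continuous_real continuous_intros\<close>)
  moreover have "integral {0..2 * pi} k = 2 * of_real pi * \<i> * h w"
    using I by (rule integral_unique)
  ultimately have "2 * pi * cmod (h w) \<le> integral {0..2 * pi} (\<lambda>t. cmod (h (cis t))) / (1 - cmod w)"
    by (simp add: norm_mult)
  then show ?thesis
    using w by (simp add: field_simps)
qed

text \<open>A stand-in for a holomorphic branch of \<open>f powr q\<close>: only its modulus
  matters, and in this form products need no matching of arguments. The closed disc appears because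
  Cauchy's formula is used on the unit circle itself.\<close>

definition has_modulus_power :: "real \<Rightarrow> (complex \<Rightarrow> complex) \<Rightarrow> bool" where
  "has_modulus_power q f \<longleftrightarrow>
     (\<exists>h. continuous_on (cball 0 1) h \<and> h holomorphic_on ball 0 1 \<and>
        (\<forall>z\<in>cball 0 1. cmod (h z) = cmod (f z) powr q))"

lemma has_modulus_power_const: "has_modulus_power q (\<lambda>_. c)"
  unfolding has_modulus_power_def
  by (rule exI[of _ "\<lambda>_. of_real (cmod c powr q)"]) auto

lemma has_modulus_power_mult:
  assumes "has_modulus_power q f" "has_modulus_power q g"
  shows "has_modulus_power q (\<lambda>z. f z * g z)"
proof -
  obtain h k where
    "continuous_on (cball 0 1) h" "h holomorphic_on ball 0 1" "\<forall>z\<in>cball 0 1. cmod (h z) = cmod (f z) powr q"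
    "continuous_on (cball 0 1) k" "k holomorphic_on ball 0 1" "\<forall>z\<in>cball 0 1. cmod (k z) = cmod (g z) powr q"
    using assms unfolding has_modulus_power_def by blast
  then show ?thesis
    unfolding has_modulus_power_def
    by (intro exI[of _ "\<lambda>z. h z * k z"])
      (auto intro!: continuous_intros holomorphic_intros simp: norm_mult powr_mult)
qed

text \<open>For \<open>cmod b < 1\<close> the values \<open>1 - b * z\<close> stay in the right
  half-plane, where the principal logarithm is holomorphic.\<close>

lemma has_modulus_power_linear:
  assumes b: "cmod b < 1"
  shows "has_modulus_power q (\<lambda>z. 1 - b * z)"
proof -
  have re: "0 < Re (1 - b * z)" if "z \<in> cball 0 1" for z
  proof -
    have "Re (b * z) \<le> cmod b * cmod z" by (metis complex_Re_le_cmod norm_mult)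
    also have "\<dots> \<le> cmod b" using that by (auto intro: mult_left_le)
    finally show ?thesis using b by simp
  qed
  then have nz: "1 - b * z \<notin> \<real>\<^sub>\<le>\<^sub>0" if "z \<in> cball 0 1" for z
    using that by (metis complex_nonpos_Reals_iff not_less)
  have ne: "1 - b * z \<noteq> 0" if "z \<in> cball 0 1" for z
    using nz[OF that] by auto
  show ?thesis
    unfolding has_modulus_power_def
  proof (intro exI[of _ "\<lambda>z. exp (of_real q * Ln (1 - b * z))"] conjI ballI)
    show "continuous_on (cball 0 1) (\<lambda>z. exp (of_real q * Ln (1 - b * z)))"
      using nz by (auto intro!: continuous_intros)
    show "(\<lambda>z. exp (of_real q * Ln (1 - b * z))) holomorphic_on ball 0 1"
      using nz by (auto intro!: holomorphic_intros)
    show "cmod (exp (of_real q * Ln (1 - b * z))) = cmod (1 - b * z) powr q" if "z \<in> cball 0 1" for z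
      using ne[OF that] by (simp add: norm_exp_eq_Re powr_def)
  qed
qed

text \<open>\<open>1 - cnj a * z\<close> is the quotient of \<open>z - a\<close> by the Blaschke
  factor \<open>(z - a) / (1 - cnj a * z)\<close>. For \<open>1 < t\<close> neither branch vanishes
  on the closed disc.\<close>

definition moved_factor :: "real \<Rightarrow> complex \<Rightarrow> complex \<Rightarrow> complex" where
  "moved_factor t a z = (if cmod a < 1 then 1 - cnj a * z else z - of_real t * a)"

lemma has_modulus_power_moved_factor:
  assumes "1 < t"
  shows "has_modulus_power q (moved_factor t a)"
proof (cases "cmod a < 1")
  case True
  then show ?thesis
    using has_modulus_power_linear[of "cnj a" q] by (simp add: moved_factor_def[abs_def])
next
  case False
  \<comment> \<open>The reciprocal of the moved zero: \<open>z - t * a\<close> is a constant times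
    \<open>1 - b * z\<close>, which reduces this case to the linear one.\<close>
  define b where "b = 1 / (of_real t * a)"
  have a0: "a \<noteq> 0" using False by auto
  have "cmod b = 1 / (t * cmod a)" using assms by (simp add: b_def norm_divide norm_mult)
  also have "\<dots> < 1"
  proof -
    have "1 * 1 < t * cmod a" using assms False by (intro mult_less_le_imp_less) auto
    then show ?thesis by (simp add: field_simps)
  qed
  finally have "has_modulus_power q (\<lambda>z. (- of_real t * a) * (1 - b * z))"
    by (intro has_modulus_power_mult has_modulus_power_const has_modulus_power_linear)
  moreover have "(\<lambda>z. (- of_real t * a) * (1 - b * z)) = moved_factor t a"
    using False assms a0 by (auto simp: moved_factor_def b_def field_simps)
  ultimately show ?thesis by simp
qed

lemma has_modulus_power_prod_moved_factor:
  assumes "1 < t"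
  shows "has_modulus_power q (\<lambda>z. \<Prod>a\<in>#A. moved_factor t a z)"
  by (induction A)
    (auto intro!: has_modulus_power_const[where c=1] has_modulus_power_mult
        has_modulus_power_moved_factor assms)

text \<open>For a zero inside, the squared moduli differ by
  \<open>(1 - (cmod a)\<^sup>2) * (1 - (cmod z)\<^sup>2)\<close>. For a zero outside, the closed
  disc lies in the half-plane \<open>Re (z * cnj a) \<le> (cmod a)\<^sup>2\<close>, so pushing
  \<open>a\<close> outward along its ray increases the distance to every \<open>z\<close> in the
  disc.\<close>

lemma norm_le_moved_factor:
  assumes z: "cmod z \<le> 1" and t: "1 \<le> t"
  shows "cmod (z - a) \<le> cmod (moved_factor t a z)"
proof (cases "cmod a < 1")
  case True
  have eq: "(cmod (1 - cnj a * z))\<^sup>2 - (cmod (z - a))\<^sup>2 = (1 - (cmod a)\<^sup>2) * (1 - (cmod z)\<^sup>2)"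
    unfolding cmod_power2 by (simp add: algebra_simps power2_eq_square)
  have "0 \<le> (1 - (cmod a)\<^sup>2) * (1 - (cmod z)\<^sup>2)"
    using True z by (intro mult_nonneg_nonneg) (auto simp: power_le_one)
  then have "(cmod (z - a))\<^sup>2 \<le> (cmod (1 - cnj a * z))\<^sup>2" using eq by linarith
  then show ?thesis
    using True power2_le_imp_le[of "cmod (z - a)" "cmod (moved_factor t a z)"] by (simp add: moved_factor_def)
next
  case False
  have r: "Re (z * cnj a) \<le> (cmod a)\<^sup>2"
  proof -
    have "Re (z * cnj a) \<le> cmod z * cmod a" by (metis complex_Re_le_cmod norm_mult complex_mod_cnj)
    also have "\<dots> \<le> 1 * cmod a" using z by (intro mult_right_mono) auto
    also have "\<dots> \<le> (cmod a)\<^sup>2" using False by (simp add: power2_eq_square mult_left_le_one_le mult_le_cancel_left1)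
    finally show ?thesis .
  qed
  have "(cmod (z - of_real t * a))\<^sup>2 - (cmod (z - a))\<^sup>2
      = (t - 1) * ((t + 1) * (cmod a)\<^sup>2 - 2 * Re (z * cnj a))"
    unfolding cmod_power2 by (simp add: algebra_simps power2_eq_square)
  moreover have "0 \<le> (t - 1) * ((t + 1) * (cmod a)\<^sup>2 - 2 * Re (z * cnj a))"
  proof (intro mult_nonneg_nonneg)
    have "2 * (cmod a)\<^sup>2 \<le> (t + 1) * (cmod a)\<^sup>2" using t by (intro mult_right_mono) auto
    then show "0 \<le> (t + 1) * (cmod a)\<^sup>2 - 2 * Re (z * cnj a)" using r by linarith
  qed (use t in auto)
  ultimately have "(cmod (z - a))\<^sup>2 \<le> (cmod (z - of_real t * a))\<^sup>2" by linarith
  then show ?thesis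
    using False power2_le_imp_le[of "cmod (z - a)" "cmod (moved_factor t a z)"] by (simp add: moved_factor_def)
qed

lemma norm_prod_le_moved_factor:
  assumes "cmod z \<le> 1" "1 \<le> t"
  shows "cmod (\<Prod>a\<in>#A. z - a) \<le> cmod (\<Prod>a\<in>#A. moved_factor t a z)"
  by (induction A) (auto simp: norm_mult intro!: mult_mono norm_le_moved_factor assms)

lemma norm_moved_factor_circle:
  assumes "cmod z = 1"
  shows "cmod (moved_factor 1 a z) = cmod (z - a)"
proof (cases "cmod a < 1")
  case True
  have eq: "(cmod (1 - cnj a * z))\<^sup>2 - (cmod (z - a))\<^sup>2 = (1 - (cmod a)\<^sup>2) * (1 - (cmod z)\<^sup>2)"
    unfolding cmod_power2 by (simp add: algebra_simps power2_eq_square)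
  then have "(cmod (1 - cnj a * z))\<^sup>2 = (cmod (z - a))\<^sup>2" using assms by simp
  then show ?thesis using True by (simp add: moved_factor_def)
qed (simp add: moved_factor_def)

lemma norm_prod_moved_factor_circle:
  assumes "cmod z = 1"
  shows "cmod (\<Prod>a\<in>#A. moved_factor 1 a z) = cmod (\<Prod>a\<in>#A. z - a)"
  by (induction A) (auto simp: norm_mult norm_moved_factor_circle assms)

text \<open>Joint continuity in \<open>t\<close> and \<open>\<theta>\<close> is what lets
  \<open>t\<close> tend to 1 under the integral sign.\<close>

lemma continuous_on_prod_moved_factor:
  "continuous_on UNIV (\<lambda>(t, \<theta>). \<Prod>a\<in>#A. moved_factor t a (cis \<theta>))"
proof (induction A)
  case (add x A)
  have "continuous_on UNIV (\<lambda>(t, \<theta>). moved_factor t x (cis \<theta>))"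
    by (cases "cmod x < 1") (auto simp: moved_factor_def case_prod_unfold intro!: continuous_intros)
  with add show ?case by (auto simp: case_prod_unfold intro!: continuous_intros)
qed (simp add: case_prod_unfold)

text \<open>
  The power \<open>q\<close> may be smaller than 1, so zeros have to be removed before Cauchy's formula
  can be applied to a branch of \<open>f powr q\<close>. A zero inside the disc is divided out by a Blaschke factor,
  which does not change the modulus on the circle; a zero \<open>a\<close> elsewhere is pushed
  away from the circle to \<open>t a\<close>, and \<open>t\<close> tends to 1.
\<close>

lemma poly_mean_bound:
  assumes q: "0 < q" and w: "cmod w < 1"
  shows "cmod (poly P w) powr q * (1 - cmod w) * (2 * pi)
    \<le> integral {0..2 * pi} (\<lambda>\<theta>. cmod (poly P (cis \<theta>)) powr q)"
proof (cases "P = 0")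
  case True
  then show ?thesis using q by simp
next
  case False
  obtain A where A: "P = smult (lead_coeff P) (\<Prod>x\<in>#A. [:-x, 1:])"
    using alg_closed_imp_factorization[OF False] by (elim exE conjE) (rule that)
  define c where "c = lead_coeff P"
  have P: "poly P z = c * (\<Prod>a\<in>#A. z - a)" for z
  proof -
    have "poly (\<Prod>x\<in>#A. [:-x, 1:]) z = (\<Prod>a\<in>#A. z - a)" for z
      by (induction A) (auto simp: algebra_simps)
    then show ?thesis by (subst A) (simp add: c_def)
  qed
  define G where "G = (\<lambda>t z. c * (\<Prod>a\<in>#A. moved_factor t a z))"
  have bound: "cmod (poly P w) powr q * (1 - cmod w) * (2 * pi)
      \<le> integral {0..2 * pi} (\<lambda>\<theta>. cmod (G t (cis \<theta>)) powr q)" if t: "1 < t" for t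
  proof -
    have "has_modulus_power q (G t)"
      unfolding G_def
      by (intro has_modulus_power_mult has_modulus_power_const has_modulus_power_prod_moved_factor t)
    then obtain h where h: "continuous_on (cball 0 1) h" "h holomorphic_on ball 0 1"
      "\<And>z. cmod z \<le> 1 \<Longrightarrow> cmod (h z) = cmod (G t z) powr q"
      by (auto simp: has_modulus_power_def)
    have "cmod (poly P w) \<le> cmod (G t w)"
      using norm_prod_le_moved_factor[of w t A] w t by (auto simp: P G_def norm_mult intro!: mult_left_mono)
    then have "cmod (poly P w) powr q \<le> cmod (G t w) powr q"
      using q by (intro powr_mono2) auto
    then have "cmod (poly P w) powr q * (1 - cmod w) * (2 * pi) \<le> cmod (h w) * (1 - cmod w) * (2 * pi)"
      using w h(3)[of w] by (intro mult_right_mono) auto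
    also have "\<dots> \<le> integral {0..2 * pi} (\<lambda>t. cmod (h (cis t)))"
      by (intro Cauchy_mean_bound h w)
    also have "\<dots> = integral {0..2 * pi} (\<lambda>\<theta>. cmod (G t (cis \<theta>)) powr q)"
      by (simp add: h(3))
    finally show ?thesis .
  qed
  \<comment> \<open>The endpoint \<open>t = 1\<close> is included although \<open>G 1\<close> may
    vanish on the circle: \<open>powr q\<close> is continuous at 0 because \<open>q\<close> is
    positive. The 2 is just some number above 1.\<close>
  have "continuous_on ({1..2} \<times> cbox 0 (2 * pi)) (\<lambda>(t, \<theta>). cmod (G t (cis \<theta>)) powr q)"
    using continuous_on_subset[OF continuous_on_prod_moved_factor subset_UNIV, of _ A] q
    unfolding G_def case_prod_unfold by (intro continuous_intros continuous_on_powr') auto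
  then have "continuous_on {1..2} (\<lambda>t. integral (cbox 0 (2 * pi)) (\<lambda>\<theta>. cmod (G t (cis \<theta>)) powr q))"
    by (rule integral_continuous_on_param)
  from continuous_on_Icc_at_rightD[OF this]
  have "((\<lambda>t. integral {0..2 * pi} (\<lambda>\<theta>. cmod (G t (cis \<theta>)) powr q)) \<longlongrightarrow>
      integral {0..2 * pi} (\<lambda>\<theta>. cmod (G 1 (cis \<theta>)) powr q)) (at_right 1)"
    by simp
  then have "cmod (poly P w) powr q * (1 - cmod w) * (2 * pi)
      \<le> integral {0..2 * pi} (\<lambda>\<theta>. cmod (G 1 (cis \<theta>)) powr q)"
    by (rule tendsto_lowerbound)
      (auto simp: eventually_at_right_field intro!: exI[of _ 2] bound)
  then show ?thesis
    by (simp add: G_def P norm_mult norm_prod_moved_factor_circle)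
qed

text \<open>Passage from Taylor polynomials to their limit. Since \<open>S\<close> exceeds 1, the
  coefficients are absolutely summable, so the polynomials are uniformly bounded on the circle and
  dominated convergence applies.\<close>

lemma holomorphic_mean_bound:
  assumes q: "0 < q" and holo: "f holomorphic_on ball 0 S" and S: "1 < S" and w: "cmod w < 1"
  shows "cmod (f w) powr q * (1 - cmod w) * (2 * pi)
    \<le> integral {0..2 * pi} (\<lambda>\<theta>. cmod (f (cis \<theta>)) powr q)"
proof -
  define c where "c = (\<lambda>n. (deriv ^^ n) f 0 / fact n)"
  have sums: "(\<lambda>n. c n * z ^ n) sums f z" if "cmod z < S" for z
    using holomorphic_power_series[OF holo, of z] that by (simp add: c_def)
  define P where "P = (\<lambda>k. \<Sum>n<k. monom (c n) n)"
  have P: "poly (P k) z = (\<Sum>n<k. c n * z ^ n)" for k z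
    by (simp add: P_def poly_sum poly_monom)
  have lim: "(\<lambda>k. poly (P k) z) \<longlonglongrightarrow> f z" if "cmod z < S" for z
    using sums[OF that] by (simp add: P sums_def)
  obtain s where s: "1 < s" "s < S" using S dense by blast
  have "summable (\<lambda>n. norm (c n * 1 ^ n))"
    using sums[of "of_real s"] s by (intro powser_insidea[of c "of_real s"]) (auto simp: sums_iff)
  then have sm: "summable (\<lambda>n. cmod (c n))" by simp
  define M where "M = (\<Sum>n. cmod (c n))"
  have PM: "cmod (poly (P k) (cis \<theta>)) \<le> M" for k \<theta>
  proof -
    have "cmod (poly (P k) (cis \<theta>)) \<le> (\<Sum>n<k. cmod (c n))"
      unfolding P by (rule order_trans[OF norm_sum]) (simp add: norm_mult norm_power)
    also have "\<dots> \<le> M" unfolding M_def by (intro sum_le_suminf sm) auto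
    finally show ?thesis .
  qed
  have plim: "(\<lambda>k. cmod (poly (P k) z) powr q) \<longlonglongrightarrow> cmod (f z) powr q" if "cmod z < S" for z
    by (intro tendsto_powr' tendsto_norm lim that) (use q in auto)
  have "(\<lambda>k. integral {0..2 * pi} (\<lambda>\<theta>. cmod (poly (P k) (cis \<theta>)) powr q))
      \<longlonglongrightarrow> integral {0..2 * pi} (\<lambda>\<theta>. cmod (f (cis \<theta>)) powr q)"
  proof (rule dominated_convergence(2)[where h="\<lambda>_. M powr q"])
    show "(\<lambda>\<theta>. cmod (poly (P k) (cis \<theta>)) powr q) integrable_on {0..2 * pi}" for k
      by (intro integrable_continuous_real continuous_on_powr' continuous_intros) (use q in auto)
    show "norm (cmod (poly (P k) (cis x)) powr q) \<le> M powr q" for k x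
      using PM[of k x] q by (auto intro!: powr_mono2)
  qed (use S in \<open>auto intro!: plim\<close>)
  moreover have "(\<lambda>k. cmod (poly (P k) w) powr q * (1 - cmod w) * (2 * pi))
      \<longlonglongrightarrow> cmod (f w) powr q * (1 - cmod w) * (2 * pi)"
    by (intro tendsto_intros plim) (use w S in auto)
  ultimately show ?thesis
    by (rule tendsto_le[OF sequentially_bot]) (use poly_mean_bound[OF q w] in simp)
qed

text \<open>Rescaling the circle of radius \<open>R\<close> to the unit circle sends
  \<open>w\<close> to \<open>w / R\<close>, and the rescaled function is holomorphic up to radius
  \<open>1 / R > 1\<close>.\<close>

lemma norm_le_integral_mean:
  assumes q: "0 < q" and holo: "f holomorphic_on disc" and R: "0 < R" "R < 1" and w: "cmod w < R"
  shows "cmod (f w) * (1 - cmod w / R) powr (1 / q) \<le> integral_mean q f R"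
proof -
  have *: "cmod (f (of_real R * (w / R))) powr q * (1 - cmod (w / R)) * (2 * pi)
      \<le> integral {0..2 * pi} (\<lambda>\<theta>. cmod (f (of_real R * cis \<theta>)) powr q)"
  proof (rule holomorphic_mean_bound[OF q, of "\<lambda>z. f (of_real R * z)" "1 / R"])
    have "(\<lambda>z. of_real R * z) ` ball 0 (1 / R) \<subseteq> disc"
      using R by (auto simp: norm_mult field_simps)
    then show "(\<lambda>z. f (of_real R * z)) holomorphic_on ball 0 (1 / R)"
      using holomorphic_on_compose_gen[of "\<lambda>z. of_real R * z" "ball 0 (1 / R)" f disc] holo
      by (auto simp: o_def intro!: holomorphic_intros)
  qed (use R w in \<open>auto simp: norm_divide\<close>)
  have x: "0 \<le> 1 - cmod w / R" using R w by (simp add: field_simps)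
  from * have "cmod (f w) powr q * (1 - cmod w / R)
      \<le> 1 / (2 * pi) * integral {0..2 * pi} (\<lambda>\<theta>. cmod (f (rcis R \<theta>)) powr q)"
    using R by (simp add: rcis_def norm_divide field_simps)
  then have "(cmod (f w) powr q * (1 - cmod w / R)) powr (1 / q) \<le> integral_mean q f R"
    unfolding integral_mean_def using q x by (intro powr_mono2) auto
  then show ?thesis
    using q x by (simp add: powr_mult powr_powr)
qed

section \<open>Growth of functions in the mixed norm space\<close>

text \<open>Monotonicity of the two quotients is recast as a comparison of \<open>\<phi>\<close> at
  two radii, the form in which the estimates consume it. Once \<open>a\<close> and \<open>b\<close>
  have been chosen from \<open>\<phi>\<close>, every constant built here depends on
  \<open>p\<close>, \<open>q\<close>, \<open>\<phi>\<close> and \<open>n\<close> only.\<close>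

locale mixed_norm_setting =
  fixes p q a b :: real and \<phi> :: "real \<Rightarrow> real"
  assumes p_pos: "0 < p" and q_pos: "0 < q" and a_pos: "0 < a" and a_less_b: "a < b"
    and \<phi>_pos: "\<And>r. 0 \<le> r \<Longrightarrow> r < 1 \<Longrightarrow> 0 < \<phi> r"
    and \<phi>_upper: "\<And>r s. 0 \<le> r \<Longrightarrow> r \<le> s \<Longrightarrow> s < 1 \<Longrightarrow> \<phi> s \<le> \<phi> r * ((1 - s) / (1 - r)) powr a"
    and \<phi>_lower: "\<And>r s. 0 \<le> r \<Longrightarrow> r \<le> s \<Longrightarrow> s < 1 \<Longrightarrow> \<phi> r * ((1 - s) / (1 - r)) powr b \<le> \<phi> s"

lemma mixed_norm_setting_of_normal_function:
  assumes "0 < p" "0 < q" "normal_function \<phi>"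
  obtains a b where "mixed_norm_setting p q a b \<phi>"
proof -
  obtain a b where ab: "0 < a" "a < b" and pos: "\<forall>r\<in>{0..<1}. 0 < \<phi> r"
    and anti: "antimono_on {0..<1} (\<lambda>r. \<phi> r / (1 - r) powr a)"
    and mono: "mono_on {0..<1} (\<lambda>r. \<phi> r / (1 - r) powr b)"
    using assms(3) unfolding normal_function_def by blast
  have "mixed_norm_setting p q a b \<phi>"
  proof
    show "\<phi> s \<le> \<phi> r * ((1 - s) / (1 - r)) powr a" if "0 \<le> r" "r \<le> s" "s < 1" for r s
      using monotone_onD[OF anti, of r s] that by (simp add: powr_divide field_simps)
    show "\<phi> r * ((1 - s) / (1 - r)) powr b \<le> \<phi> s" if "0 \<le> r" "r \<le> s" "s < 1" for r s
      using mono_onD[OF mono, of r s] that by (simp add: powr_divide field_simps)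
  qed (use assms ab pos in auto)
  then show ?thesis by (rule that)
qed

context mixed_norm_setting
begin

lemma b_pos: "0 < b"
  using a_pos a_less_b by linarith

lemma \<phi>_antimono: "\<phi> s \<le> \<phi> r" if "0 \<le> r" "r \<le> s" "s < 1"
proof -
  have "((1 - s) / (1 - r)) powr a \<le> 1 powr a"
    using that a_pos by (intro powr_mono2) auto
  then have "\<phi> r * ((1 - s) / (1 - r)) powr a \<le> \<phi> r * 1"
    using \<phi>_pos[of r] that by (intro mult_left_mono) auto
  then show ?thesis using \<phi>_upper[OF that] by simp
qed

lemma integral_mean_lower_bound:
  assumes holo: "f holomorphic_on disc" and w: "cmod w < 1"
    and R: "1 - (1 - cmod w) / 2 \<le> R" "R \<le> 1 - (1 - cmod w) / 4"
  shows "cmod (f w) * ((1 - cmod w) / 2) powr (1 / q) * \<phi> (cmod w) * (1 / 4) powr b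
    \<le> integral_mean q f R * \<phi> R"
proof -
  have cR: "cmod w < R" using R w by (simp add: field_simps)
  then have "0 < R" using norm_ge_zero[of w] by linarith
  then have R': "0 < R" "R < 1" "cmod w < R" "(1 - cmod w) / 2 \<le> R - cmod w" "(1 - cmod w) / 4 \<le> 1 - R"
    using R w cR by (auto simp: field_simps)
  have "R - cmod w \<le> 1 - cmod w / R"
  proof -
    have "(R - cmod w) * R \<le> (R - cmod w) * 1" using R' by (intro mult_left_mono) auto
    then show ?thesis using R' by (simp add: field_simps)
  qed
  with R' have "(1 - cmod w) / 2 \<le> 1 - cmod w / R" by linarith
  then have "((1 - cmod w) / 2) powr (1 / q) \<le> (1 - cmod w / R) powr (1 / q)"
    using w q_pos by (intro powr_mono2) auto
  then have 1: "cmod (f w) * ((1 - cmod w) / 2) powr (1 / q) \<le> integral_mean q f R"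
    using norm_le_integral_mean[OF q_pos holo R'(1-3)]
    by (meson mult_left_mono norm_ge_zero order_trans)
  have "(1 / 4) powr b \<le> ((1 - R) / (1 - cmod w)) powr b"
    using R' w b_pos by (intro powr_mono2) (auto simp: field_simps)
  then have "\<phi> (cmod w) * (1 / 4) powr b \<le> \<phi> (cmod w) * ((1 - R) / (1 - cmod w)) powr b"
    using \<phi>_pos[of "cmod w"] w by (intro mult_left_mono) auto
  also have "\<dots> \<le> \<phi> R" using R' by (intro \<phi>_lower) auto
  finally have 2: "\<phi> (cmod w) * (1 / 4) powr b \<le> \<phi> R" .
  have "(cmod (f w) * ((1 - cmod w) / 2) powr (1 / q)) * (\<phi> (cmod w) * (1 / 4) powr b)
      \<le> integral_mean q f R * \<phi> R"
    using 1 2 \<phi>_pos[of "cmod w"] w by (intro mult_mono) (auto simp: integral_mean_def)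
  then show ?thesis by (simp add: mult_ac)
qed

text \<open>The lower bound for the means is integrated over its window of radii. With
  \<open>s = 1 - cmod w\<close> this window has length \<open>s / 4\<close>, and
  \<open>1 / (1 - r)\<close> is at least \<open>2 / s\<close> on it; hence its mass is at least
  \<open>1 / 2\<close>, the origin of \<open>2 powr (1 / p)\<close>.\<close>

lemma mixed_norm_pointwise:
  assumes holo: "f holomorphic_on disc" and w: "cmod w < 1"
    and K: "0 \<le> K" "mixed_norm p q \<phi> f \<le> ennreal K"
  shows "cmod (f w) * ((1 - cmod w) / 2) powr (1 / q) * \<phi> (cmod w) * (1 / 4) powr b \<le> 2 powr (1 / p) * K"
    (is "?X \<le> _")
proof -
  define s where "s = 1 - cmod w"
  have s: "0 < s" "s \<le> 1" using w by (auto simp: s_def)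
  define I where
    "I = (\<integral>\<^sup>+ r\<in>{0..<1}. ennreal (integral_mean q f r powr p * (\<phi> r powr p / (1 - r))) \<partial>lborel)"
  have X: "0 \<le> ?X" using \<phi>_pos[of "cmod w"] w by (intro mult_nonneg_nonneg) auto
  have "ennreal (?X powr p / 2) = ennreal (?X powr p * (2 / s)) * ennreal (s / 4)"
    using s by (simp add: ennreal_mult[symmetric])
  also have "ennreal (s / 4) = emeasure lborel {1 - s / 2..1 - s / 4}"
    using s by (simp add: field_simps)
  also have "ennreal (?X powr p * (2 / s)) * \<dots>
      = (\<integral>\<^sup>+ r\<in>{1 - s / 2..1 - s / 4}. ennreal (?X powr p * (2 / s)) \<partial>lborel)"
    by (subst nn_integral_cmult_indicator) auto
  also have "\<dots> \<le> I"
    unfolding I_def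
  proof (intro nn_integral_mono)
    fix R
    show "ennreal (?X powr p * (2 / s)) * indicator {1 - s / 2..1 - s / 4} R
      \<le> ennreal (integral_mean q f R powr p * (\<phi> R powr p / (1 - R))) * indicator {0..<1} R"
    proof (cases "R \<in> {1 - s / 2..1 - s / 4}")
      case True
      then have R: "1 - s / 2 \<le> R" "R \<le> 1 - s / 4" "0 \<le> R" "R < 1" using s by auto
      have "?X powr p \<le> (integral_mean q f R * \<phi> R) powr p"
        using integral_mean_lower_bound[OF holo w] R(1,2) X p_pos
        by (intro powr_mono2) (auto simp: s_def)
      also have "\<dots> = integral_mean q f R powr p * \<phi> R powr p"
        using \<phi>_pos[of R] R by (simp add: powr_mult integral_mean_def)
      finally have "?X powr p * (2 / s) \<le> integral_mean q f R powr p * \<phi> R powr p * (1 / (1 - R))"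
        using R s by (intro mult_mono) (auto simp: field_simps)
      then show ?thesis using True R by (auto simp: ennreal_leI)
    qed auto
  qed
  finally have XI: "ennreal (?X powr p / 2) \<le> I" .
  \<comment> \<open>Finiteness has to be recorded, because \<open>enn2real\<close> sends infinity to
    0.\<close>
  have fin: "I \<noteq> \<infinity>" and IK: "enn2real I powr (1 / p) \<le> K"
    using K by (auto simp: mixed_norm_def I_def Let_def top_unique split: if_splits)
  have "?X powr p / 2 \<le> enn2real I"
    using enn2real_mono[OF XI] fin by (simp add: top.not_eq_extremum)
  then have "?X powr p \<le> 2 * enn2real I" by simp
  then have "(?X powr p) powr (1 / p) \<le> (2 * enn2real I) powr (1 / p)"
    using p_pos by (intro powr_mono2) auto
  also have "\<dots> = 2 powr (1 / p) * enn2real I powr (1 / p)"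
    by (simp add: powr_mult)
  also have "\<dots> \<le> 2 powr (1 / p) * K" using IK by (intro mult_left_mono) auto
  finally show ?thesis using X p_pos by (simp add: powr_powr)
qed

text \<open>The denominator in the theorem as a function of \<open>r = cmod (\<psi> z)\<close>. Its
  reciprocal bounds the \<open>n\<close>-th derivative over the unit ball, up to a constant.\<close>

definition growth :: "nat \<Rightarrow> real \<Rightarrow> real" where
  "growth n r = \<phi> r * (1 - r\<^sup>2) powr (1 / q + real n)"

lemma growth_pos: "0 < growth n r" if "0 \<le> r" "r < 1"
  using that \<phi>_pos[of r] power_strict_mono[of r 1 2] by (simp add: growth_def)

lemma growth_antimono: "growth n s \<le> growth n r" if "0 \<le> r" "r \<le> s" "s < 1"
  unfolding growth_def
  using that \<phi>_antimono[OF that] \<phi>_pos[of s] q_pos power_mono[of r s 2] power_le_one[of s 2]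
  by (intro mult_mono powr_mono2) auto

text \<open>Cauchy's inequality on the circle about \<open>w\<close> of radius half the distance
  \<open>s\<close> to the boundary. On it the pointwise bound changes only by constants, and each
  derivative costs a factor of order \<open>1 / s\<close>.\<close>

lemma higher_deriv_estimate:
  obtains C where "0 < C" and
    "\<And>f K w. f holomorphic_on disc \<Longrightarrow> 0 \<le> K \<Longrightarrow> mixed_norm p q \<phi> f \<le> ennreal K \<Longrightarrow> cmod w < 1 \<Longrightarrow>
       cmod ((deriv ^^ n) f w) * growth n (cmod w) \<le> C * K"
proof -
  \<comment> \<open>In order: the mass of the window of radii, the replacement of
    \<open>(1 - cmod u) / 2\<close> by \<open>s / 4\<close>, the loss in the pointwise bound, and
    the comparison of \<open>\<phi>\<close> at \<open>u\<close> and at \<open>w\<close>.\<close>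
  define D where "D = 2 powr (1 / p) * 4 powr (1 / q) * 4 powr b * 2 powr b"
  define C where "C = fact n * 2 ^ n * D * 2 powr (1 / q + real n)"
  have D: "0 < D" by (simp add: D_def)
  have C: "0 < C" using D by (simp add: C_def)
  have "cmod ((deriv ^^ n) f w) * growth n (cmod w) \<le> C * K"
    if holo: "f holomorphic_on disc" and K: "0 \<le> K" "mixed_norm p q \<phi> f \<le> ennreal K"
      and w: "cmod w < 1" for f K w
  proof -
    define s where "s = 1 - cmod w"
    have s: "0 < s" "s \<le> 1" using w by (auto simp: s_def)
    have pw: "0 < \<phi> (cmod w)" using w by (intro \<phi>_pos) auto
    define B where "B = D * K / (\<phi> (cmod w) * s powr (1 / q))"
    have u1: "cmod u \<le> 1 - s / 2" if "cmod (w - u) \<le> s / 2" for u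
      using norm_triangle_ineq2[of u w] that by (simp add: s_def norm_minus_commute field_simps)
    have fu: "cmod (f u) \<le> B" if u: "cmod (w - u) = s / 2" for u
    proof -
      have u': "cmod u \<le> 1 - s / 2" using u1 u by simp
      then have u'': "cmod u < 1" using s by linarith
      have "(s / 4) powr (1 / q) \<le> ((1 - cmod u) / 2) powr (1 / q)"
        using s u' q_pos by (intro powr_mono2) auto
      moreover have "\<phi> (cmod w) * (1 / 2) powr b \<le> \<phi> (cmod u)"
      proof -
        \<comment> \<open>Since \<open>\<phi>\<close> decreases, its smallest value on the circle is
          controlled at the outermost possible modulus \<open>1 - s / 2\<close>.\<close>
        have "\<phi> (cmod w) * (1 / 2) powr b \<le> \<phi> (1 - s / 2)"
        proof -
          have "\<phi> (cmod w) * ((1 - (1 - s / 2)) / (1 - cmod w)) powr b \<le> \<phi> (1 - s / 2)"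
            using s by (intro \<phi>_lower) (auto simp: s_def field_simps)
          moreover have "(1 - (1 - s / 2)) / (1 - cmod w) = 1 / 2" using s by (simp add: s_def[symmetric])
          ultimately show ?thesis by (simp only:)
        qed
        also have "\<dots> \<le> \<phi> (cmod u)" using u' s by (intro \<phi>_antimono) auto
        finally show ?thesis .
      qed
      ultimately have "cmod (f u) * ((s / 4) powr (1 / q) * (\<phi> (cmod w) * (1 / 2) powr b) * (1 / 4) powr b)
          \<le> cmod (f u) * (((1 - cmod u) / 2) powr (1 / q) * \<phi> (cmod u) * (1 / 4) powr b)"
        using pw \<phi>_pos[of "cmod u"] u'' by (intro mult_left_mono mult_mono) auto
      also have "\<dots> \<le> 2 powr (1 / p) * K"
        using mixed_norm_pointwise[OF holo u'' K] by (simp add: mult_ac)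
      finally show ?thesis
        using s pw by (simp add: B_def D_def powr_divide field_simps)
    qed
    have sub: "cball w (s / 2) \<subseteq> disc"
      using u1 s by (force simp: dist_norm)
    then have hc: "f holomorphic_on cball w (s / 2)"
      by (rule holomorphic_on_subset[OF holo])
    have "cmod ((deriv ^^ n) f w) \<le> fact n * B / (s / 2) ^ n"
      using s fu holomorphic_on_subset[OF hc ball_subset_cball] holomorphic_on_imp_continuous_on[OF hc]
      by (intro Cauchy_inequality) auto
    also have "\<dots> = fact n * 2 ^ n * D * K / (\<phi> (cmod w) * s powr (1 / q + real n))"
      using s by (simp add: B_def power_divide powr_add powr_realpow field_simps)
    finally have 1: "cmod ((deriv ^^ n) f w) * (\<phi> (cmod w) * s powr (1 / q + real n)) \<le> fact n * 2 ^ n * D * K"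
      using s pw by (simp add: field_simps)
    have "1 - (cmod w)\<^sup>2 = s * (1 + cmod w)"
      by (simp add: s_def power2_eq_square algebra_simps)
    also have "\<dots> \<le> s * 2" using s w by (intro mult_left_mono) auto
    finally have "growth n (cmod w) \<le> \<phi> (cmod w) * (s * 2) powr (1 / q + real n)"
      unfolding growth_def using pw w q_pos
      by (intro mult_left_mono powr_mono2) (auto simp: power_le_one)
    also have "\<dots> = \<phi> (cmod w) * s powr (1 / q + real n) * 2 powr (1 / q + real n)"
      using s by (simp add: powr_mult)
    finally have "cmod ((deriv ^^ n) f w) * growth n (cmod w)
        \<le> (cmod ((deriv ^^ n) f w) * (\<phi> (cmod w) * s powr (1 / q + real n))) * 2 powr (1 / q + real n)"
      by (simp add: mult.assoc mult_left_mono)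
    also have "\<dots> \<le> (fact n * 2 ^ n * D * K) * 2 powr (1 / q + real n)"
      by (intro mult_right_mono 1) auto
    finally show ?thesis by (simp add: C_def mult_ac)
  qed
  with C show ?thesis by (rule that)
qed

end

section \<open>Integral means and the mixed norm\<close>

lemma integral_mean_nonneg: "0 \<le> integral_mean q f r"
  by (simp add: integral_mean_def)

lemma continuous_on_circle:
  assumes "f holomorphic_on disc" "0 \<le> r" "r < 1"
  shows "continuous_on S (\<lambda>\<theta>. f (rcis r \<theta>))"
  using assms unfolding rcis_def
  by (intro continuous_on_compose2[OF holomorphic_on_imp_continuous_on[OF assms(1)]] continuous_intros)
    (auto simp: norm_mult)

lemma integrable_norm_powr_circle:
  assumes "0 < q" "f holomorphic_on disc" "0 \<le> r" "r < 1"
  shows "(\<lambda>\<theta>. cmod (f (rcis r \<theta>)) powr q) integrable_on {0..2 * pi}"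
  by (intro integrable_continuous_real continuous_on_powr' continuous_on_norm continuous_on_circle
      continuous_on_const) (use assms in auto)

lemma integral_mean_cmult:
  assumes "0 < q"
  shows "integral_mean q (\<lambda>z. c * f z) r = cmod c * integral_mean q f r"
proof -
  have "1 / (2 * pi) * integral {0..2 * pi} (\<lambda>\<theta>. cmod (c * f (rcis r \<theta>)) powr q)
      = cmod c powr q * (1 / (2 * pi) * integral {0..2 * pi} (\<lambda>\<theta>. cmod (f (rcis r \<theta>)) powr q))"
    by (simp add: norm_mult powr_mult)
  then show ?thesis
    unfolding integral_mean_def using assms by (simp only: powr_mult powr_powr) simp
qed

lemma integral_mean_le:
  assumes q: "0 < q" and c: "0 \<le> c"
    and "integral {0..2 * pi} (\<lambda>\<theta>. cmod (f (rcis r \<theta>)) powr q) \<le> 2 * pi * c powr q"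
    and "0 \<le> integral {0..2 * pi} (\<lambda>\<theta>. cmod (f (rcis r \<theta>)) powr q)"
  shows "integral_mean q f r \<le> c"
proof -
  have "integral_mean q f r \<le> (c powr q) powr (1 / q)"
    unfolding integral_mean_def using assms by (intro powr_mono2) (auto simp: field_simps)
  then show ?thesis using q c by (simp add: powr_powr)
qed

lemma integral_mean_powr:
  assumes "0 < q" "0 \<le> integral {0..2 * pi} (\<lambda>\<theta>. cmod (f (rcis r \<theta>)) powr q)"
  shows "2 * pi * integral_mean q f r powr q = integral {0..2 * pi} (\<lambda>\<theta>. cmod (f (rcis r \<theta>)) powr q)"
  using assms by (simp add: integral_mean_def powr_powr)

text \<open>Minkowski's inequality fails for \<open>q < 1\<close>, so \<open>q\<close>-th powers are
  compared pointwise. The constant is the \<open>q\<close>-th root of \<open>2 powr q * 2\<close>.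
  The maximum fits the later majorization by two radial profiles.\<close>

lemma integral_mean_diff_le:
  assumes q: "0 < q" and holo: "f holomorphic_on disc" "g holomorphic_on disc" and r: "0 \<le> r" "r < 1"
  shows "integral_mean q (\<lambda>z. f z - g z) r
    \<le> 2 powr (1 + 1 / q) * max (integral_mean q f r) (integral_mean q g r)"
proof (rule integral_mean_le[OF q])
  let ?m = "max (integral_mean q f r) (integral_mean q g r)"
  have int: "(\<lambda>\<theta>. cmod (h (rcis r \<theta>)) powr q) integrable_on {0..2 * pi}" if "h holomorphic_on disc" for h
    using that by (intro integrable_norm_powr_circle q r)
  have nonneg: "0 \<le> integral {0..2 * pi} (\<lambda>\<theta>. cmod (h (rcis r \<theta>)) powr q)" if "h holomorphic_on disc" for h
    using int[OF that] by (rule integral_nonneg) auto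
  have hd: "(\<lambda>z. f z - g z) holomorphic_on disc" by (intro holomorphic_intros holo)
  show "0 \<le> integral {0..2 * pi} (\<lambda>\<theta>. cmod (f (rcis r \<theta>) - g (rcis r \<theta>)) powr q)"
    using nonneg[OF hd] .
  have pt: "cmod (x - y) powr q \<le> 2 powr q * (cmod x powr q + cmod y powr q)" for x y :: complex
  proof -
    have "cmod (x - y) \<le> 2 * max (cmod x) (cmod y)" using norm_triangle_ineq4[of x y] by simp
    then have "cmod (x - y) powr q \<le> (2 * max (cmod x) (cmod y)) powr q"
      using q by (intro powr_mono2) auto
    also have "\<dots> = 2 powr q * max (cmod x) (cmod y) powr q" by (simp add: powr_mult)
    also have "\<dots> \<le> 2 powr q * (cmod x powr q + cmod y powr q)"
      by (intro mult_left_mono) (auto simp: max_def)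
    finally show ?thesis .
  qed
  have "(\<lambda>\<theta>. cmod (f (rcis r \<theta>)) powr q + cmod (g (rcis r \<theta>)) powr q) integrable_on {0..2 * pi}"
    by (rule integrable_add[OF int int]) (rule holo)+
  then have "integral {0..2 * pi} (\<lambda>\<theta>. cmod (f (rcis r \<theta>) - g (rcis r \<theta>)) powr q)
      \<le> integral {0..2 * pi} (\<lambda>\<theta>. 2 powr q * (cmod (f (rcis r \<theta>)) powr q + cmod (g (rcis r \<theta>)) powr q))"
    using int[OF hd] pt by (intro integral_le integrable_on_cmult_left) auto
  also have "\<dots> = 2 powr q * (2 * pi * integral_mean q f r powr q + 2 * pi * integral_mean q g r powr q)"
    using int holo by (simp add: integral_add integral_mean_powr[OF q nonneg])
  also have "\<dots> \<le> 2 powr q * (2 * pi * ?m powr q + 2 * pi * ?m powr q)"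
    using q by (intro mult_left_mono add_mono powr_mono2) (auto simp: integral_mean_nonneg)
  also have "\<dots> = 2 * pi * (2 powr (1 + 1 / q) * ?m) powr q"
  proof -
    have "(1 + 1 / q) * q = q + 1" using q by (simp add: field_simps)
    then have "(2 powr (1 + 1 / q)) powr q = 2 powr q * (2 :: real)"
      unfolding powr_powr by (simp add: powr_add)
    then show ?thesis unfolding powr_mult by simp
  qed
  finally show "integral {0..2 * pi} (\<lambda>\<theta>. cmod (f (rcis r \<theta>) - g (rcis r \<theta>)) powr q)
      \<le> 2 * pi * (2 powr (1 + 1 / q) * ?m) powr q" .
qed (auto simp: integral_mean_nonneg le_max_iff_disj)

text \<open>Cauchy's formula for \<open>1 / (1 - cnj u * z)\<close> at the point \<open>u\<close>
  itself. On the circle \<open>v - u = v * cnj (1 - cnj u * v)\<close>, which makes the integrand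
  \<open>\<i>\<close> times the wanted real function; the imaginary part extracts it.\<close>

lemma has_integral_Poisson:
  assumes u: "cmod u < 1"
  shows "((\<lambda>\<theta>. 1 / (cmod (1 - cnj u * cis \<theta>))\<^sup>2) has_integral 2 * pi / (1 - (cmod u)\<^sup>2)) {0..2 * pi}"
proof -
  define h where "h = (\<lambda>z. 1 / (1 - cnj u * z))"
  have ne: "cnj u * z \<noteq> 1" if "cmod z \<le> 1" for z
  proof
    assume "cnj u * z = 1"
    then have "cmod (cnj u * z) = 1" by simp
    moreover have "cmod (cnj u * z) \<le> cmod u" using that by (auto simp: norm_mult intro: mult_left_le)
    ultimately show False using u by simp
  qed
  have "((\<lambda>v. h v / (v - u)) has_contour_integral (2 * of_real pi * \<i> * h u)) (circlepath 0 1)"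
  proof (rule Cauchy_integral_circlepath)
    show "continuous_on (cball 0 1) h"
      unfolding h_def by (intro continuous_intros) (use ne in force)
    show "h holomorphic_on ball 0 1"
      unfolding h_def by (intro holomorphic_intros) (use ne in force)
  qed (use u in simp)
  then have "((\<lambda>v. h v / (v - u)) has_contour_integral (2 * of_real pi * \<i> * h u))
      (part_circlepath 0 1 0 (2 * pi))"
    by (simp add: circlepath_def)
  then have "((\<lambda>\<theta>. h (cis \<theta>) / (cis \<theta> - u) * (\<i> * cis \<theta>)) has_integral (2 * of_real pi * \<i> * h u)) {0..2 * pi}"
    by (subst (asm) has_contour_integral_part_circlepath_iff) (simp_all add: mult_ac)
  from has_integral_linear[OF this bounded_linear_Im]
  have "((\<lambda>\<theta>. Im (h (cis \<theta>) / (cis \<theta> - u) * (\<i> * cis \<theta>))) has_integral Im (2 * of_real pi * \<i> * h u)) {0..2 * pi}"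
    by (simp add: o_def)
  moreover have "h (cis \<theta>) / (cis \<theta> - u) * (\<i> * cis \<theta>) = \<i> * of_real (1 / (cmod (1 - cnj u * cis \<theta>))\<^sup>2)" for \<theta>
  proof -
    have "cis \<theta> - u = cis \<theta> * cnj (1 - cnj u * cis \<theta>)"
      by (simp add: algebra_simps cis_cnj cis_mult flip: mult.assoc)
    then have "h (cis \<theta>) / (cis \<theta> - u) * (\<i> * cis \<theta>)
        = \<i> * (1 / ((1 - cnj u * cis \<theta>) * cnj (1 - cnj u * cis \<theta>)))"
      by (simp add: h_def)
    then show ?thesis
      by (simp only: complex_norm_square[symmetric]) simp
  qed
  moreover have "2 * of_real pi * \<i> * h u = \<i> * of_real (2 * pi / (1 - (cmod u)\<^sup>2))"
    by (simp add: h_def mult.commute[of "cnj u"] complex_norm_square[symmetric])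
  ultimately show ?thesis by simp
qed

section \<open>A radial majorant with uniformly bounded mixed norm\<close>

context mixed_norm_setting
begin

text \<open>Exceeding \<open>2 / q\<close> allows a Poisson kernel to be split off from the
  \<open>q\<close>-th power of the kernel; exceeding \<open>1 / q + b\<close> makes
  \<open>gap\<close> larger than \<open>b\<close>. An integer keeps the kernel rational, so its
  derivatives are explicit.\<close>

definition kernel_exponent :: nat where
  "kernel_exponent = nat \<lceil>2 / q + b\<rceil> + 1"

lemma kernel_exponent: "2 / q + b < real kernel_exponent"
  using b_pos q_pos unfolding kernel_exponent_def by (simp add: add_pos_pos) linarith

text \<open>The exponent left in the integral mean of the kernel: averaging over the angle gains
  \<open>1 / q\<close>.\<close>

abbreviation gap :: real where
  "gap \<equiv> real kernel_exponent - 1 / q"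

lemma gap: "b < gap" "0 < gap" "2 \<le> real kernel_exponent * q"
proof -
  have "0 < 1 / q" using q_pos by simp
  then have *: "2 / q < real kernel_exponent" "b + 1 / q < real kernel_exponent"
    using kernel_exponent b_pos by linarith+
  then show "b < gap" by simp
  then show "0 < gap" using b_pos by linarith
  show "2 \<le> real kernel_exponent * q" using *(1) q_pos by (simp add: field_simps)
qed

text \<open>With \<open>\<rho> = cmod w\<close> it majorizes the integral mean of the test function
  at \<open>w\<close> times \<open>\<phi>\<close>, up to a constant. Beyond \<open>\<rho>\<close>
  the decay of \<open>\<phi>\<close> at rate \<open>a\<close> makes it small; before
  \<open>\<rho>\<close> the kernel, with exponent \<open>gap\<close>, outweighs the rate
  \<open>b\<close> of \<open>\<phi>\<close>.\<close>

definition profile :: "real \<Rightarrow> real \<Rightarrow> real" where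
  "profile \<rho> r = (if \<rho> \<le> r then ((1 - r) / (1 - \<rho>)) powr a else ((1 - r) / (1 - \<rho>)) powr (- (gap - b)))"

lemma has_integral_powr_quotient:
  fixes \<rho> e c d :: real
  assumes \<rho>: "\<rho> < 1" and e: "e \<noteq> 0" and cd: "c \<le> d" "d \<le> 1" and d1: "d < 1 \<or> 0 < e"
  shows "((\<lambda>r. ((1 - r) / (1 - \<rho>)) powr e / (1 - r)) has_integral
    (((1 - c) / (1 - \<rho>)) powr e - ((1 - d) / (1 - \<rho>)) powr e) / e) {c..d}"
proof -
  define F where "F = (\<lambda>r. - (((1 - r) / (1 - \<rho>)) powr e) / e)"
  have "((\<lambda>r. ((1 - r) / (1 - \<rho>)) powr e / (1 - r)) has_integral (F d - F c)) {c..d}"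
  \<comment> \<open>For \<open>d = 1\<close> the antiderivative is only continuous at the endpoint,
    and this needs \<open>0 < e\<close>; hence the interior version and the hypothesis
    \<open>d1\<close>.\<close>
  proof (rule fundamental_theorem_of_calculus_interior[OF cd(1)])
    show "continuous_on {c..d} F"
      unfolding F_def using \<rho> e cd d1
      by (intro continuous_intros continuous_on_powr') auto
    fix x assume x: "x \<in> {c<..<d}"
    then have x1: "x < 1" using cd by simp
    define X where "X = (1 - x) / (1 - \<rho>)"
    have X: "0 < X" using x1 \<rho> by (simp add: X_def)
    have "((\<lambda>r. (1 - r) / (1 - \<rho>)) has_real_derivative - 1 / (1 - \<rho>)) (at x)"
      by (intro DERIV_cdivide) (auto intro!: derivative_eq_intros)
    with has_real_derivative_powr[OF X, of e]
    have "((\<lambda>r. ((1 - r) / (1 - \<rho>)) powr e) has_real_derivative e * X powr (e - 1) * (- 1 / (1 - \<rho>))) (at x)"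
      unfolding X_def by (rule DERIV_chain2)
    then have "(F has_real_derivative - (e * X powr (e - 1) * (- 1 / (1 - \<rho>))) / e) (at x)"
      unfolding F_def by (intro DERIV_cdivide DERIV_minus)
    moreover have "- (e * X powr (e - 1) * (- 1 / (1 - \<rho>))) / e = X powr e / (X * (1 - \<rho>))"
      using e X by (simp add: powr_diff)
    ultimately have "(F has_real_derivative ((1 - x) / (1 - \<rho>)) powr e / (1 - x)) (at x)"
      using \<rho> by (simp add: X_def)
    then show "(F has_vector_derivative ((1 - x) / (1 - \<rho>)) powr e / (1 - x)) (at x)"
      by (simp add: has_real_derivative_iff_has_vector_derivative)
  qed
  then show ?thesis by (simp add: F_def diff_divide_distrib)
qed

lemma has_integral_profile:
  assumes \<rho>: "0 \<le> \<rho>" "\<rho> < 1"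
  obtains v where "((\<lambda>r. profile \<rho> r powr p / (1 - r)) has_integral v) {0..1}"
    "v \<le> 1 / (a * p) + 1 / ((gap - b) * p)"
proof -
  let ?k = "\<lambda>r. profile \<rho> r powr p / (1 - r)"
  define e where "e = (b - gap) * p"
  have ap: "0 < a * p" and e: "e < 0" using a_pos p_pos gap(1) by (auto simp: e_def mult_neg_pos)
  have "((\<lambda>r. ((1 - r) / (1 - \<rho>)) powr (a * p) / (1 - r)) has_integral
      (((1 - \<rho>) / (1 - \<rho>)) powr (a * p) - ((1 - 1) / (1 - \<rho>)) powr (a * p)) / (a * p)) {\<rho>..1}"
    using \<rho> ap by (intro has_integral_powr_quotient) auto
  then have 1: "((\<lambda>r. ((1 - r) / (1 - \<rho>)) powr (a * p) / (1 - r)) has_integral 1 / (a * p)) {\<rho>..1}"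
    using \<rho> by simp
  have 1: "(?k has_integral 1 / (a * p)) {\<rho>..1}"
    by (rule has_integral_eq[OF _ 1]) (auto simp: profile_def powr_powr)
  have 2: "((\<lambda>r. ((1 - r) / (1 - \<rho>)) powr e / (1 - r)) has_integral
      (((1 - 0) / (1 - \<rho>)) powr e - ((1 - \<rho>) / (1 - \<rho>)) powr e) / e) {0..\<rho>}"
    using \<rho> e by (intro has_integral_powr_quotient) auto
  have 2: "(?k has_integral (((1 - 0) / (1 - \<rho>)) powr e - ((1 - \<rho>) / (1 - \<rho>)) powr e) / e) {0..\<rho>}"
    using \<rho> by (intro has_integral_spike[OF negligible_sing[of \<rho>] _ 2])
      (auto simp: profile_def powr_powr e_def)
  have "(((1 - 0) / (1 - \<rho>)) powr e - ((1 - \<rho>) / (1 - \<rho>)) powr e) / e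
      = 1 / (- e) - (1 / (1 - \<rho>)) powr e / (- e)"
    using \<rho> e by (simp add: diff_divide_distrib)
  \<comment> \<open>The contribution of the endpoint 0 has a favourable sign. Dropping it makes the
    bound independent of \<open>\<rho>\<close>.\<close>
  also have "\<dots> \<le> 1 / (- e)" using e by (simp add: divide_nonneg_neg)
  also have "1 / (- e) = 1 / ((gap - b) * p)" by (simp add: e_def algebra_simps)
  finally have "(((1 - 0) / (1 - \<rho>)) powr e - ((1 - \<rho>) / (1 - \<rho>)) powr e) / e \<le> 1 / ((gap - b) * p)" .
  then show ?thesis
    by (intro that[OF has_integral_combine[OF _ _ 2 1]]) (use \<rho> in auto)
qed

definition profile_norm :: real where
  "profile_norm = (2 * (1 / (a * p) + 1 / ((gap - b) * p))) powr (1 / p)"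

lemma profile_norm_pos: "0 < profile_norm"
proof -
  have "0 < 1 / (a * p) + 1 / ((gap - b) * p)"
    using a_pos p_pos gap(1) by (intro add_pos_pos divide_pos_pos mult_pos_pos) auto
  then have "0 < 2 * (1 / (a * p) + 1 / ((gap - b) * p))" by (intro mult_pos_pos) auto
  then show ?thesis unfolding profile_norm_def powr_gt_zero by (metis less_irrefl)
qed

lemma mixed_norm_le_profile:
  assumes \<rho>: "0 \<le> \<rho>" "\<rho> < 1" and \<sigma>: "0 \<le> \<sigma>" "\<sigma> < 1" and A: "0 \<le> A"
    and le: "\<And>r. 0 \<le> r \<Longrightarrow> r < 1 \<Longrightarrow> integral_mean q f r * \<phi> r \<le> A * max (profile \<rho> r) (profile \<sigma> r)"
  shows "mixed_norm p q \<phi> f \<le> ennreal (A * profile_norm)"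
proof -
  define V where "V = 1 / (a * p) + 1 / ((gap - b) * p)"
  obtain v where v: "((\<lambda>r. profile \<rho> r powr p / (1 - r)) has_integral v) {0..1}" "v \<le> V"
    using has_integral_profile[OF \<rho>] unfolding V_def by blast
  obtain u where u: "((\<lambda>r. profile \<sigma> r powr p / (1 - r)) has_integral u) {0..1}" "u \<le> V"
    using has_integral_profile[OF \<sigma>] unfolding V_def by blast
  define k where "k = (\<lambda>r. A powr p * (profile \<rho> r powr p / (1 - r) + profile \<sigma> r powr p / (1 - r)))"
  have k: "(k has_integral A powr p * (v + u)) {0..1}"
    unfolding k_def by (intro has_integral_mult_right has_integral_add v u)
  have V: "0 \<le> V" using a_pos p_pos gap(1) by (simp add: V_def)
  define I where
    "I = (\<integral>\<^sup>+ r\<in>{0..<1}. ennreal (integral_mean q f r powr p * (\<phi> r powr p / (1 - r))) \<partial>lborel)"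
  have "I \<le> (\<integral>\<^sup>+ r. ennreal (k r) * indicator {0..1} r \<partial>lborel)"
    unfolding I_def
  proof (intro nn_integral_mono)
    fix r
    show "ennreal (integral_mean q f r powr p * (\<phi> r powr p / (1 - r))) * indicator {0..<1} r
        \<le> ennreal (k r) * indicator {0..1} r"
    proof (cases "r \<in> {0..<1}")
      case True
      have m: "max x y powr p \<le> x powr p + y powr p" for x y :: real by (simp add: max_def)
      have "integral_mean q f r powr p * \<phi> r powr p = (integral_mean q f r * \<phi> r) powr p"
        by (simp add: powr_mult)
      also have "\<dots> \<le> (A * max (profile \<rho> r) (profile \<sigma> r)) powr p"
        using True le[of r] p_pos \<phi>_pos[of r]
        by (intro powr_mono2) (auto simp: integral_mean_nonneg)
      also have "\<dots> \<le> A powr p * (profile \<rho> r powr p + profile \<sigma> r powr p)"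
        by (simp add: powr_mult m mult_left_mono)
      finally have "integral_mean q f r powr p * \<phi> r powr p / (1 - r) \<le> k r"
        using True by (simp add: k_def add_divide_distrib[symmetric] divide_right_mono)
      then show ?thesis using True by (auto intro: ennreal_leI)
    qed simp
  qed
  also have "\<dots> = ennreal (A powr p * (v + u))"
    by (rule nn_integral_has_integral_lebesgue'[OF _ k]) (auto simp: k_def)
  also have "\<dots> \<le> ennreal (A powr p * (2 * V))"
    using v u by (intro ennreal_leI mult_left_mono) auto
  finally have IV: "I \<le> ennreal (A powr p * (2 * V))" .
  then have fin: "I \<noteq> \<infinity>" by (auto simp: top_unique)
  have "enn2real I \<le> A powr p * (2 * V)"
    using enn2real_mono[OF IV] V by simp
  then have "enn2real I powr (1 / p) \<le> (A powr p * (2 * V)) powr (1 / p)"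
    using p_pos by (intro powr_mono2) auto
  also have "\<dots> = A * profile_norm"
    using p_pos A by (simp add: powr_mult powr_powr profile_norm_def V_def)
  finally show ?thesis
    using fin by (simp add: mixed_norm_def I_def Let_def ennreal_leI)
qed

end

section \<open>Test functions\<close>

lemma higher_deriv_inverse_power:
  assumes "\<And>z. z \<in> S \<Longrightarrow> c * z \<noteq> 1" "open S" "z \<in> S"
  shows "(deriv ^^ n) (\<lambda>z. A / (1 - c * z) ^ N) z
    = A * pochhammer (of_nat N) n * c ^ n / (1 - c * z) ^ (N + n)"
  using assms(3)
proof (induction n arbitrary: z)
  case (Suc n)
  let ?B = "A * pochhammer (of_nat N) n * c ^ n"
  have ev: "\<forall>\<^sub>F z in nhds z. (deriv ^^ n) (\<lambda>z. A / (1 - c * z) ^ N) z = ?B / (1 - c * z) ^ (N + n)"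
    using eventually_nhds_in_open[OF assms(2) Suc.prems] by eventually_elim (rule Suc.IH)
  have ne: "1 - c * z \<noteq> 0" using assms(1)[OF Suc.prems] by simp
  have "((\<lambda>z. ?B / (1 - c * z) ^ (N + n)) has_field_derivative
      ?B * (of_nat (N + n) * c) / (1 - c * z) ^ (N + Suc n)) (at z)"
  \<comment> \<open>The power rule is applied with exponent \<open>Suc m\<close>; for
    \<open>N + n = 0\<close> the function is constant and both sides vanish.\<close>
  proof (cases "N + n")
    case (Suc m)
    define u where "u = 1 - c * z"
    have "((\<lambda>z. (1 - c * z) ^ Suc m) has_field_derivative of_nat (Suc m) * u ^ m * - c) (at z)"
    proof -
      have "((\<lambda>z. 1 - c * z) has_field_derivative - c) (at z)"
        by (auto intro!: derivative_eq_intros)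
      from DERIV_power[OF this, of "Suc m"] show ?thesis by (simp add: u_def mult_ac)
    qed
    then have "((\<lambda>z. ?B * inverse ((1 - c * z) ^ Suc m)) has_field_derivative
        ?B * - (of_nat (Suc m) * u ^ m * - c * inverse ((u ^ Suc m) ^ Suc (Suc 0)))) (at z)"
      unfolding u_def by (intro DERIV_cmult DERIV_inverse_fun) (use ne in auto)
    moreover have "?B * - (of_nat (Suc m) * u ^ m * - c * inverse ((u ^ Suc m) ^ Suc (Suc 0)))
        = ?B * (of_nat (Suc m) * c) / u ^ Suc (Suc m)"
      using ne by (simp add: u_def[symmetric] field_simps)
    ultimately have "((\<lambda>z. ?B * inverse ((1 - c * z) ^ Suc m)) has_field_derivative
        ?B * (of_nat (Suc m) * c) / u ^ Suc (Suc m)) (at z)" by (simp only:)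
    then show ?thesis
      unfolding add_Suc_right Suc u_def divide_inverse .
  qed (auto intro!: derivative_eq_intros)
  then have "deriv (\<lambda>z. ?B / (1 - c * z) ^ (N + n)) z = ?B * (of_nat (N + n) * c) / (1 - c * z) ^ (N + Suc n)"
    by (rule DERIV_imp_deriv)
  then show ?case
    using deriv_cong_ev[OF ev refl] by (simp add: pochhammer_Suc mult_ac)
qed simp

section \<open>The test functions and their uniform bounds\<close>

context mixed_norm_setting
begin

text \<open>At \<open>z = w\<close> the \<open>n\<close>-th derivative of the kernel has order
  \<open>(1 - (cmod w)\<^sup>2) powr (- (kernel_exponent + n))\<close>; this coefficient leaves
  exactly the order of \<open>1 / growth n (cmod w)\<close> as \<open>w\<close> approaches the
  circle.\<close>

definition test_coeff :: "complex \<Rightarrow> real" where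
  "test_coeff w = (1 - (cmod w)\<^sup>2) powr gap / \<phi> (cmod w)"

definition test_fun :: "complex \<Rightarrow> complex \<Rightarrow> complex" where
  "test_fun w z =
     (if z \<in> disc then of_real (test_coeff w) / (1 - cnj w * z) ^ kernel_exponent else 0)"

lemma test_coeff_nonneg: "cmod w < 1 \<Longrightarrow> 0 \<le> test_coeff w"
  using \<phi>_pos[of "cmod w"] by (simp add: test_coeff_def)

lemma kernel_denominator:
  assumes "cmod w < 1" "cmod z \<le> 1"
  shows "1 - cmod w * cmod z \<le> cmod (1 - cnj w * z)" "0 < 1 - cmod w * cmod z" "cnj w * z \<noteq> 1"
proof -
  show 1: "1 - cmod w * cmod z \<le> cmod (1 - cnj w * z)"
    using norm_triangle_ineq2[of 1 "cnj w * z"] by (simp add: norm_mult)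
  have "cmod w * cmod z \<le> cmod w" using assms by (auto intro: mult_left_le)
  then show 2: "0 < 1 - cmod w * cmod z" using assms by simp
  show "cnj w * z \<noteq> 1" using 1 2 by auto
qed

lemma test_fun_holo_disc: "test_fun w \<in> holo_disc" if w: "cmod w < 1"
proof -
  have "(\<lambda>z. of_real (test_coeff w) / (1 - cnj w * z) ^ kernel_exponent) holomorphic_on disc"
    using kernel_denominator(3)[OF w] by (intro holomorphic_intros) force
  then have "test_fun w holomorphic_on disc"
    by (rule holomorphic_transform) (auto simp: test_fun_def)
  then show ?thesis by (auto simp: holo_disc_def test_fun_def)
qed

text \<open>Of the exponent \<open>kernel_exponent * q\<close> of the kernel, 2 is reserved for the
  exact Poisson integral and the rest, which is nonnegative, is bounded by its maximum on the
  circle. The Poisson integral contributes one more inverse power of \<open>1 - cmod w * r\<close>,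
  so the total exponent is \<open>1 - kernel_exponent * q = - gap * q\<close>.\<close>

lemma integral_mean_test_fun:
  assumes w: "cmod w < 1" and r: "0 \<le> r" "r < 1"
  shows "integral_mean q (test_fun w) r \<le> test_coeff w * (1 - cmod w * r) powr (- gap)"
proof (rule integral_mean_le[OF q_pos])
  let ?N = "real kernel_exponent" and ?x = "1 - cmod w * r"
  define u where "u = w * of_real r"
  have cu: "cmod u = cmod w * r" using r by (simp add: u_def norm_mult)
  have u: "cmod u < 1" using w r mult_strict_mono[of "cmod w" 1 r 1] by (cases "w = 0") (auto simp: cu)
  have x: "0 < ?x" "?x \<le> 1" using u r by (simp_all add: cu)
  have rc: "cnj w * rcis r \<theta> = cnj u * cis \<theta>" for \<theta> by (simp add: u_def rcis_def)
  have tf: "test_fun w (rcis r \<theta>) = of_real (test_coeff w) / (1 - cnj u * cis \<theta>) ^ kernel_exponent" for \<theta>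
    using r by (simp add: test_fun_def rc)
  have int: "(\<lambda>\<theta>. cmod (test_fun w (rcis r \<theta>)) powr q) integrable_on {0..2 * pi}"
    using test_fun_holo_disc[OF w] by (intro integrable_norm_powr_circle q_pos r) (simp add: holo_disc_def)
  then show "0 \<le> integral {0..2 * pi} (\<lambda>\<theta>. cmod (test_fun w (rcis r \<theta>)) powr q)"
    by (rule integral_nonneg) auto
  have pt: "cmod (test_fun w (rcis r \<theta>)) powr q
      \<le> test_coeff w powr q * ?x powr (2 - ?N * q) * (1 / (cmod (1 - cnj u * cis \<theta>))\<^sup>2)" for \<theta>
  proof -
    let ?y = "cmod (1 - cnj u * cis \<theta>)"
    have y: "?x \<le> ?y" using kernel_denominator(1)[OF u, of "cis \<theta>"] by (simp add: cu)
    with x have y0: "0 < ?y" by linarith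
    have "cmod (test_fun w (rcis r \<theta>)) powr q = (test_coeff w / ?y powr ?N) powr q"
      using test_coeff_nonneg[OF w] by (simp only: powr_realpow[OF y0] tf) (simp add: norm_divide norm_power)
    also have "\<dots> = test_coeff w powr q * ?y powr (- (?N * q))"
      unfolding powr_divide powr_powr powr_minus by (simp add: divide_inverse)
    also have "\<dots> = test_coeff w powr q * (?y powr (2 - ?N * q) * ?y powr (- 2))"
      by (simp flip: powr_add)
    also have "\<dots> \<le> test_coeff w powr q * (?x powr (2 - ?N * q) * ?y powr (- 2))"
      using x y gap(3) by (intro mult_left_mono mult_right_mono powr_mono2') auto
    also have "?y powr (- 2) = 1 / ?y\<^sup>2" using x y by (simp add: powr_minus divide_inverse)
    finally show ?thesis by (simp add: mult.assoc)
  qed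
  have "((\<lambda>\<theta>. test_coeff w powr q * ?x powr (2 - ?N * q) * (1 / (cmod (1 - cnj u * cis \<theta>))\<^sup>2)) has_integral
      test_coeff w powr q * ?x powr (2 - ?N * q) * (2 * pi / (1 - (cmod u)\<^sup>2))) {0..2 * pi}"
    by (intro has_integral_mult_right has_integral_Poisson u)
  from has_integral_le[OF integrable_integral[OF int] this pt]
  have "integral {0..2 * pi} (\<lambda>\<theta>. cmod (test_fun w (rcis r \<theta>)) powr q)
      \<le> test_coeff w powr q * ?x powr (2 - ?N * q) * (2 * pi / (1 - (cmod u)\<^sup>2))" .
  also have "\<dots> \<le> test_coeff w powr q * ?x powr (2 - ?N * q) * (2 * pi / ?x)"
  proof (intro mult_left_mono divide_left_mono)
    have "(cmod u)\<^sup>2 \<le> cmod u" using u by (simp add: power2_eq_square mult_left_le)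
    then show "?x \<le> 1 - (cmod u)\<^sup>2" by (simp add: cu)
    with x show "0 < (1 - (cmod u)\<^sup>2) * ?x" by (intro mult_pos_pos) linarith+
  qed auto
  also have "\<dots> = 2 * pi * (test_coeff w powr q * (?x powr (2 - ?N * q) * ?x powr (- 1)))"
    using x by (simp add: powr_minus divide_inverse)
  also have "?x powr (2 - ?N * q) * ?x powr (- 1) = ?x powr ((- gap) * q)"
  proof -
    have "2 - ?N * q + - 1 = (- gap) * q" using q_pos by (simp add: field_simps)
    then show ?thesis by (simp only: powr_add[symmetric])
  qed
  also have "test_coeff w powr q * ?x powr ((- gap) * q) = (test_coeff w * ?x powr (- gap)) powr q"
    by (simp only: powr_mult powr_powr)
  finally show "integral {0..2 * pi} (\<lambda>\<theta>. cmod (test_fun w (rcis r \<theta>)) powr q)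
      \<le> 2 * pi * (test_coeff w * ?x powr (- gap)) powr q" .
qed (use test_coeff_nonneg[OF w] in auto)

text \<open>For \<open>r\<close> beyond \<open>\<rho> = cmod w\<close> the kernel factor is at most
  1 and the upper comparison for \<open>\<phi>\<close> gives the decay. For smaller
  \<open>r\<close>, \<open>1 - \<rho> * r\<close> is at least \<open>1 - r\<close>, and the lower
  comparison for \<open>\<phi>\<close> costs the exponent \<open>b\<close>. The factor
  \<open>2 powr gap\<close> comes from
  \<open>1 - \<rho>\<^sup>2 \<le> 2 * (1 - \<rho>)\<close>.\<close>

lemma integral_mean_test_fun_profile:
  assumes w: "cmod w < 1" and r: "0 \<le> r" "r < 1"
  shows "integral_mean q (test_fun w) r * \<phi> r \<le> 2 powr gap * profile (cmod w) r"
proof -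
  define \<rho> where "\<rho> = cmod w"
  have \<rho>: "0 \<le> \<rho>" "\<rho> < 1" using w by (auto simp: \<rho>_def)
  have pos: "0 < \<phi> \<rho>" "0 < \<phi> r" using \<phi>_pos \<rho> r by auto
  have \<rho>r: "\<rho> * r \<le> \<rho>" "\<rho> * r \<le> r" using \<rho> r by (auto intro: mult_left_le mult_left_le_one_le)
  have x: "0 < 1 - \<rho> * r" using \<rho>r \<rho> by linarith
  have "1 - \<rho>\<^sup>2 = (1 - \<rho>) * (1 + \<rho>)" by (simp add: power2_eq_square algebra_simps)
  also have "\<dots> \<le> (1 - \<rho>) * 2" using \<rho> by (intro mult_left_mono) auto
  finally have "(1 - \<rho>\<^sup>2) powr gap \<le> ((1 - \<rho>) * 2) powr gap"
    using \<rho> gap(2) by (intro powr_mono2) (auto simp: power_le_one)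
  then have "(1 - \<rho>\<^sup>2) powr gap \<le> 2 powr gap * (1 - \<rho>) powr gap"
    by (simp only: powr_mult mult.commute)
  then have c: "test_coeff w \<le> 2 powr gap * ((1 - \<rho>) powr gap / \<phi> \<rho>)"
    using pos unfolding test_coeff_def \<rho>_def[symmetric] times_divide_eq_right
    by (intro divide_right_mono) auto
  have "integral_mean q (test_fun w) r * \<phi> r \<le> (test_coeff w * (1 - \<rho> * r) powr (- gap)) * \<phi> r"
    using integral_mean_test_fun[OF w r] pos by (intro mult_right_mono) (auto simp: \<rho>_def)
  also have "\<dots> \<le> (2 powr gap * ((1 - \<rho>) powr gap / \<phi> \<rho>) * (1 - \<rho> * r) powr (- gap)) * \<phi> r"
    using c pos by (intro mult_right_mono) auto
  also have "\<dots> = 2 powr gap * (((1 - \<rho>) / (1 - \<rho> * r)) powr gap * (\<phi> r / \<phi> \<rho>))"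
    unfolding powr_divide powr_minus by (simp add: divide_inverse)
  also have "\<dots> \<le> 2 powr gap * profile \<rho> r"
  proof (intro mult_left_mono)
    show "((1 - \<rho>) / (1 - \<rho> * r)) powr gap * (\<phi> r / \<phi> \<rho>) \<le> profile \<rho> r"
    proof (cases "\<rho> \<le> r")
      case True
      have "((1 - \<rho>) / (1 - \<rho> * r)) powr gap \<le> 1 powr gap"
        using \<rho> \<rho>r x gap(2) by (intro powr_mono2) auto
      moreover have "\<phi> r / \<phi> \<rho> \<le> ((1 - r) / (1 - \<rho>)) powr a"
        using \<phi>_upper[OF \<rho>(1) True r(2)] pos by (simp add: field_simps)
      ultimately have "((1 - \<rho>) / (1 - \<rho> * r)) powr gap * (\<phi> r / \<phi> \<rho>) \<le> 1 * ((1 - r) / (1 - \<rho>)) powr a"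
        using pos by (intro mult_mono) auto
      then show ?thesis using True by (simp add: profile_def)
    next
      case False
      let ?X = "(1 - r) / (1 - \<rho>)"
      have X: "0 < ?X" using r \<rho> by simp
      have "((1 - \<rho>) / (1 - \<rho> * r)) powr gap \<le> (1 / ?X) powr gap"
        using \<rho> \<rho>r x r gap(2) by (intro powr_mono2) (auto simp: frac_le)
      moreover have "\<phi> r / \<phi> \<rho> \<le> ?X powr b"
      proof -
        have "\<phi> r * (1 / ?X) powr b \<le> \<phi> \<rho>" using \<phi>_lower[of r \<rho>] False r \<rho> by simp
        then show ?thesis using pos r \<rho> by (simp add: powr_divide field_simps)
      qed
      ultimately have "((1 - \<rho>) / (1 - \<rho> * r)) powr gap * (\<phi> r / \<phi> \<rho>) \<le> (1 / ?X) powr gap * ?X powr b"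
        using pos by (intro mult_mono) auto
      also have "(1 / ?X) powr gap = ?X powr (- gap)"
        using X by (simp only: powr_minus powr_divide powr_one_eq_one inverse_eq_divide)
      also have "?X powr (- gap) * ?X powr b = ?X powr (- (gap - b))"
      proof -
        have "- gap + b = - (gap - b)" by simp
        then show ?thesis by (simp only: powr_add[symmetric])
      qed
      finally show ?thesis using False by (simp add: profile_def)
    qed
  qed auto
  finally show ?thesis by (simp add: \<rho>_def)
qed

text \<open>Its reciprocal scales every difference of two test functions into the unit ball.\<close>

definition test_bound :: real where
  "test_bound = 2 powr (1 + 1 / q) * 2 powr gap * profile_norm"

lemma test_bound_pos: "0 < test_bound"
  using profile_norm_pos by (simp add: test_bound_def)

lemma mixed_norm_test_fun_diff:
  assumes w: "cmod w < 1" and v: "cmod v < 1"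
  shows "mixed_norm p q \<phi> (\<lambda>z. c * (test_fun w z - test_fun v z)) \<le> ennreal (cmod c * test_bound)"
proof -
  let ?A = "cmod c * (2 powr (1 + 1 / q) * 2 powr gap)"
  have "mixed_norm p q \<phi> (\<lambda>z. c * (test_fun w z - test_fun v z)) \<le> ennreal (?A * profile_norm)"
  proof (rule mixed_norm_le_profile[of "cmod w" "cmod v"])
    fix r :: real assume r: "0 \<le> r" "r < 1"
    have \<phi>r: "0 < \<phi> r" using \<phi>_pos r by auto
    have "integral_mean q (\<lambda>z. test_fun w z - test_fun v z) r * \<phi> r
      \<le> 2 powr (1 + 1 / q) * max (integral_mean q (test_fun w) r) (integral_mean q (test_fun v) r) * \<phi> r"
      using test_fun_holo_disc[OF w] test_fun_holo_disc[OF v] \<phi>r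
      by (intro mult_right_mono integral_mean_diff_le q_pos r) (auto simp: holo_disc_def)
    also have "\<dots> = 2 powr (1 + 1 / q)
        * max (integral_mean q (test_fun w) r * \<phi> r) (integral_mean q (test_fun v) r * \<phi> r)"
      using \<phi>r by (simp add: max_mult_distrib_right)
    also have "\<dots> \<le> 2 powr (1 + 1 / q) * max (2 powr gap * profile (cmod w) r) (2 powr gap * profile (cmod v) r)"
      by (intro mult_left_mono max.mono integral_mean_test_fun_profile w v r) auto
    also have "\<dots> = 2 powr (1 + 1 / q) * (2 powr gap * max (profile (cmod w) r) (profile (cmod v) r))"
      by (simp add: max_mult_distrib_left)
    finally have "cmod c * (integral_mean q (\<lambda>z. test_fun w z - test_fun v z) r * \<phi> r)
        \<le> cmod c * (2 powr (1 + 1 / q) * (2 powr gap * max (profile (cmod w) r) (profile (cmod v) r)))"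
      by (intro mult_left_mono) auto
    then show "integral_mean q (\<lambda>z. c * (test_fun w z - test_fun v z)) r * \<phi> r
        \<le> ?A * max (profile (cmod w) r) (profile (cmod v) r)"
      by (simp add: integral_mean_cmult[OF q_pos] mult.assoc)
  qed (use w v in auto)
  then show ?thesis by (simp add: test_bound_def mult.assoc)
qed

lemma mixed_norm_test_fun:
  assumes w: "cmod w < 1"
  shows "mixed_norm p q \<phi> (\<lambda>z. c * test_fun w z) \<le> ennreal (cmod c * 2 powr gap * profile_norm)"
proof (rule mixed_norm_le_profile[of "cmod w" "cmod w"])
  fix r :: real assume r: "0 \<le> r" "r < 1"
  have "cmod c * (integral_mean q (test_fun w) r * \<phi> r) \<le> cmod c * (2 powr gap * profile (cmod w) r)"
    by (intro mult_left_mono integral_mean_test_fun_profile w r) auto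
  then show "integral_mean q (\<lambda>z. c * test_fun w z) r * \<phi> r
      \<le> cmod c * 2 powr gap * max (profile (cmod w) r) (profile (cmod w) r)"
    by (simp add: integral_mean_cmult[OF q_pos] mult.assoc)
qed (use w in auto)

definition disc_power :: "nat \<Rightarrow> complex \<Rightarrow> complex" where
  "disc_power n z = (if z \<in> disc then z ^ n else 0)"

lemma disc_power_mixed_space: "disc_power n \<in> mixed_space p q \<phi>"
proof -
  have "(\<lambda>z. z ^ n) holomorphic_on disc" by (intro holomorphic_intros)
  then have holo: "disc_power n holomorphic_on disc"
    by (rule holomorphic_transform) (simp add: disc_power_def)
  have "mixed_norm p q \<phi> (disc_power n) \<le> ennreal (\<phi> 0 * profile_norm)"
  proof (rule mixed_norm_le_profile[of 0 0])
    fix r :: real assume r: "0 \<le> r" "r < 1"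
    have int: "(\<lambda>\<theta>. cmod (disc_power n (rcis r \<theta>)) powr q) integrable_on {0..2 * pi}"
      by (intro integrable_norm_powr_circle q_pos r holo)
    have "integral {0..2 * pi} (\<lambda>\<theta>. cmod (disc_power n (rcis r \<theta>)) powr q) \<le> integral {0..2 * pi} (\<lambda>_. 1)"
    proof (rule integral_le[OF int])
      fix \<theta>
      have "cmod (disc_power n (rcis r \<theta>)) powr q \<le> 1 powr q"
        using r q_pos by (intro powr_mono2) (auto simp: disc_power_def norm_power power_le_one)
      then show "cmod (disc_power n (rcis r \<theta>)) powr q \<le> 1" by simp
    qed auto
    then have "integral_mean q (disc_power n) r \<le> 1"
      by (intro integral_mean_le q_pos integral_nonneg int) auto
    then have "integral_mean q (disc_power n) r * \<phi> r \<le> 1 * (\<phi> 0 * ((1 - r) / (1 - 0)) powr a)"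
      using \<phi>_upper[of 0 r] r \<phi>_pos[of r] by (intro mult_mono) (auto simp: integral_mean_nonneg)
    then show "integral_mean q (disc_power n) r * \<phi> r \<le> \<phi> 0 * max (profile 0 r) (profile 0 r)"
      using r by (simp add: profile_def)
  qed (use \<phi>_pos[of 0] in auto)
  then have "mixed_norm p q \<phi> (disc_power n) < \<infinity>"
    by (metis ennreal_less_top infinity_ennreal_def order_le_less_trans)
  then show ?thesis
    using holo by (auto simp: mixed_space_def holo_disc_def disc_power_def)
qed

section \<open>Derivatives of the test functions\<close>

lemma higher_deriv_test_fun:
  assumes w: "cmod w < 1" and z: "cmod z < 1"
  shows "(deriv ^^ n) (test_fun w) z = of_real (test_coeff w) * pochhammer (of_nat kernel_exponent) n * cnj w ^ n
    / (1 - cnj w * z) ^ (kernel_exponent + n)"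
proof -
  have holo: "(\<lambda>z. of_real (test_coeff w) / (1 - cnj w * z) ^ kernel_exponent) holomorphic_on disc"
    using kernel_denominator(3)[OF w] by (intro holomorphic_intros) force
  have "(deriv ^^ n) (test_fun w) z = (deriv ^^ n) (\<lambda>z. of_real (test_coeff w) / (1 - cnj w * z) ^ kernel_exponent) z"
    using test_fun_holo_disc[OF w] holo z
    by (intro higher_deriv_transform_within_open[of _ disc]) (auto simp: holo_disc_def test_fun_def)
  also have "\<dots> = of_real (test_coeff w) * pochhammer (of_nat kernel_exponent) n * cnj w ^ n
    / (1 - cnj w * z) ^ (kernel_exponent + n)"
    using kernel_denominator(3)[OF w] z by (intro higher_deriv_inverse_power[of disc]) auto
  finally show ?thesis .
qed

lemma kernel_exponent_pochhammer: "1 \<le> pochhammer (real kernel_exponent) n"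
proof -
  have "(1::real) \<le> real kernel_exponent" by (simp add: kernel_exponent_def)
  then show ?thesis
    by (induction n) (auto simp: pochhammer_Suc intro!: mult_ge1_I)
qed

lemma norm_higher_deriv_test_fun:
  assumes w: "cmod w < 1" and z: "cmod z < 1"
  shows "cmod ((deriv ^^ n) (test_fun w) z) = test_coeff w * pochhammer (real kernel_exponent) n * cmod w ^ n
    / cmod (1 - cnj w * z) ^ (kernel_exponent + n)"
proof -
  have "pochhammer (of_nat kernel_exponent) n = complex_of_real (pochhammer (real kernel_exponent) n)"
    by (simp add: pochhammer_of_real[symmetric])
  then show ?thesis
    using test_coeff_nonneg[OF w] kernel_exponent_pochhammer[of n]
    by (simp add: higher_deriv_test_fun[OF assms] norm_mult norm_divide norm_power)
qed

text \<open>At \<open>z = w\<close> the denominator is a power of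
  \<open>1 - (cmod w)\<^sup>2\<close> and the exponents combine to \<open>- (1 / q + n)\<close>. The
  restriction to \<open>1 / 2 \<le> cmod w\<close> controls the factor \<open>cnj w ^ n\<close>
  produced by differentiation.\<close>

lemma higher_deriv_test_fun_lower:
  assumes w: "1 / 2 \<le> cmod w" "cmod w < 1"
  shows "(1 / 2) ^ n / growth n (cmod w) \<le> cmod ((deriv ^^ n) (test_fun w) w)"
proof -
  let ?s = "1 - (cmod w)\<^sup>2"
  have s: "0 < ?s" using power_strict_mono[of "cmod w" 1 2] w by simp
  have pos: "0 < \<phi> (cmod w)" using \<phi>_pos w by auto
  have "1 - cnj w * w = of_real ?s"
    by (simp add: mult.commute[of "cnj w"] complex_norm_square[symmetric])
  then have d: "cmod (1 - cnj w * w) = ?s" using s by (simp only: norm_of_real abs_of_pos)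
  have "cmod ((deriv ^^ n) (test_fun w) w)
      = pochhammer (real kernel_exponent) n * cmod w ^ n * (?s powr gap / ?s powr (real (kernel_exponent + n)) / \<phi> (cmod w))"
    unfolding norm_higher_deriv_test_fun[OF w(2) w(2)] d test_coeff_def
    using s by (simp only: powr_realpow) (simp add: mult_ac)
  also have "?s powr gap / ?s powr (real (kernel_exponent + n)) = 1 / ?s powr (1 / q + real n)"
    by (simp add: powr_minus divide_inverse[of 1] flip: powr_diff powr_minus)
  finally have eq: "cmod ((deriv ^^ n) (test_fun w) w)
      = (pochhammer (real kernel_exponent) n * cmod w ^ n) / growth n (cmod w)"
    by (simp add: growth_def)
  have "1 * (1 / 2) ^ n \<le> pochhammer (real kernel_exponent) n * cmod w ^ n"
    using w kernel_exponent_pochhammer[of n] by (intro mult_mono power_mono) auto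
  then show ?thesis
    unfolding eq using growth_pos[of "cmod w" n] w by (intro divide_right_mono) auto
qed

text \<open>
  The test functions tend to 0 locally uniformly as \<open>w\<close> approaches the unit circle, because
  \<open>gap\<close> exceeds the lower order \<open>b\<close> of \<open>\<phi>\<close>.
\<close>

lemma higher_deriv_test_fun_tendsto:
  assumes w: "\<And>k. cmod (w k) < 1" and lim: "(\<lambda>k. cmod (w k)) \<longlonglongrightarrow> 1" and z: "cmod z < 1"
  shows "(\<lambda>k. (deriv ^^ n) (test_fun (w k)) z) \<longlonglongrightarrow> 0"
proof (rule Lim_null_comparison)
  define A where
    "A = pochhammer (real kernel_exponent) n / (1 - cmod z) ^ (kernel_exponent + n) * (2 powr gap / \<phi> 0)"
  have p0: "0 < \<phi> 0" using \<phi>_pos by auto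
  show "\<forall>\<^sub>F k in sequentially. cmod ((deriv ^^ n) (test_fun (w k)) z) \<le> A * (1 - cmod (w k)) powr (gap - b)"
  proof (intro always_eventually allI)
    fix k
    let ?\<rho> = "cmod (w k)"
    have \<rho>: "0 \<le> ?\<rho>" "?\<rho> < 1" using w by auto
    have "1 - ?\<rho>\<^sup>2 = (1 - ?\<rho>) * (1 + ?\<rho>)" by (simp add: power2_eq_square algebra_simps)
    also have "\<dots> \<le> (1 - ?\<rho>) * 2" using \<rho> by (intro mult_left_mono) auto
    finally have 1: "(1 - ?\<rho>\<^sup>2) powr gap \<le> ((1 - ?\<rho>) * 2) powr gap"
      using \<rho> gap(2) by (intro powr_mono2) (auto simp: power_le_one)
    \<comment> \<open>Comparison with radius 0: dividing by \<open>\<phi>\<close> costs at most the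
      exponent \<open>b\<close>, so the positive exponent \<open>gap - b\<close> survives.\<close>
    have 2: "\<phi> 0 * (1 - ?\<rho>) powr b \<le> \<phi> ?\<rho>" using \<phi>_lower[of 0 ?\<rho>] \<rho> by simp
    have "test_coeff (w k) \<le> ((1 - ?\<rho>) * 2) powr gap / (\<phi> 0 * (1 - ?\<rho>) powr b)"
      unfolding test_coeff_def using 1 2 p0 \<rho> by (intro frac_le) auto
    also have "\<dots> = 2 powr gap / \<phi> 0 * (1 - ?\<rho>) powr (gap - b)"
      by (simp only: powr_mult powr_diff[of "1 - ?\<rho>" gap b] times_divide_times_eq mult.commute)
    finally have c: "test_coeff (w k) \<le> 2 powr gap / \<phi> 0 * (1 - ?\<rho>) powr (gap - b)" .
    have "?\<rho> * cmod z \<le> cmod z" using \<rho> by (intro mult_left_le_one_le) auto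
    then have "1 - cmod z \<le> cmod (1 - cnj (w k) * z)"
      using kernel_denominator(1)[OF w[of k], of z] z by simp
    then have "cmod ((deriv ^^ n) (test_fun (w k)) z)
      \<le> (2 powr gap / \<phi> 0 * (1 - ?\<rho>) powr (gap - b)) * pochhammer (real kernel_exponent) n * 1
        / (1 - cmod z) ^ (kernel_exponent + n)"
      unfolding norm_higher_deriv_test_fun[OF w z]
      using c z \<rho> p0 kernel_exponent_pochhammer[of n] test_coeff_nonneg[OF w, of k]
      by (intro frac_le mult_mono power_mono power_le_one mult_nonneg_nonneg) auto
    then show "cmod ((deriv ^^ n) (test_fun (w k)) z) \<le> A * (1 - ?\<rho>) powr (gap - b)"
      by (simp add: A_def mult_ac)
  qed
  have "(\<lambda>k. A * (1 - cmod (w k)) powr (gap - b)) \<longlonglongrightarrow> A * (1 - 1) powr (gap - b)"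
    using gap(1) w by (intro tendsto_intros tendsto_powr' lim) (auto intro!: tendsto_intros lim always_eventually simp: less_imp_le)
  then show "(\<lambda>k. A * (1 - cmod (w k)) powr (gap - b)) \<longlonglongrightarrow> 0" by simp
qed

end

section \<open>The integration operator\<close>

text \<open>Kept apart from the mixed norm and from boundedness, so that it can be interpreted again
  with the dilated map \<open>r * \<psi>\<close>.\<close>

locale integration_setting =
  fixes \<mu> :: "complex \<Rightarrow> real" and g \<psi> :: "complex \<Rightarrow> complex"
  assumes weight: "weight \<mu>" and g_holo: "g holomorphic_on disc" and self_map: "self_map \<psi>"
begin

lemma \<mu>_pos: "0 < \<mu> (of_real (cmod z))" if "z \<in> disc"
  using weight that by (auto simp: weight_def)

lemma \<psi>_disc: "z \<in> disc \<Longrightarrow> cmod (\<psi> z) < 1"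
  using self_map by (force simp: self_map_def)

lemma integrand_holomorphic:
  assumes "f holomorphic_on disc"
  shows "(\<lambda>\<xi>. (deriv ^^ n) f (\<psi> \<xi>) * g \<xi>) holomorphic_on disc"
proof -
  have "(deriv ^^ n) f holomorphic_on disc" by (intro holomorphic_higher_deriv assms open_ball)
  then have "(\<lambda>\<xi>. (deriv ^^ n) f (\<psi> \<xi>)) holomorphic_on disc"
    using self_map holomorphic_on_compose_gen[of \<psi> disc "(deriv ^^ n) f" disc]
    by (auto simp: self_map_def o_def)
  then show ?thesis by (intro holomorphic_intros g_holo)
qed

lemma integration_operator_primitive:
  assumes "f holomorphic_on disc"
  obtains H where "\<And>z. z \<in> disc \<Longrightarrow> (H has_field_derivative (deriv ^^ n) f (\<psi> z) * g z) (at z)"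
    "\<And>z. z \<in> disc \<Longrightarrow> ((\<lambda>\<xi>. (deriv ^^ n) f (\<psi> \<xi>) * g \<xi>) has_contour_integral (H z - H 0)) (linepath 0 z)"
    "\<And>z. z \<in> disc \<Longrightarrow> integration_operator n \<psi> g f z = H z - H 0"
proof -
  obtain H where H: "\<And>z. z \<in> disc \<Longrightarrow> (H has_field_derivative (deriv ^^ n) f (\<psi> z) * g z) (at z within disc)"
    using holomorphic_convex_primitive'[OF convex_ball open_ball integrand_holomorphic[OF assms]] by blast
  have I: "((\<lambda>\<xi>. (deriv ^^ n) f (\<psi> \<xi>) * g \<xi>) has_contour_integral (H z - H 0)) (linepath 0 z)"
    if "z \<in> disc" for z
  proof -
    have "path_image (linepath 0 z) \<subseteq> disc"
      using that by (simp add: closed_segment_subset)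
    from contour_integral_primitive[OF H valid_path_linepath this] show ?thesis by simp
  qed
  show ?thesis
    by (rule that[of H])
      (use H I in \<open>auto simp: integration_operator_def at_within_open[OF _ open_ball] contour_integral_unique\<close>)
qed

lemma has_contour_integral_integration_operator:
  assumes "f holomorphic_on disc" "z \<in> disc"
  shows "((\<lambda>\<xi>. (deriv ^^ n) f (\<psi> \<xi>) * g \<xi>) has_contour_integral (integration_operator n \<psi> g f z)) (linepath 0 z)"
  using integration_operator_primitive[OF assms(1), of n] assms(2) by metis

lemma integration_operator_has_deriv:
  assumes "f holomorphic_on disc" "z \<in> disc"
  shows "(integration_operator n \<psi> g f has_field_derivative (deriv ^^ n) f (\<psi> z) * g z) (at z)"
proof -
  obtain H where H: "(H has_field_derivative (deriv ^^ n) f (\<psi> z) * g z) (at z)"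
    and eq: "\<And>z. z \<in> disc \<Longrightarrow> integration_operator n \<psi> g f z = H z - H 0"
    using integration_operator_primitive[OF assms(1), of n] assms(2) by metis
  have "((\<lambda>z. H z - H 0) has_field_derivative (deriv ^^ n) f (\<psi> z) * g z) (at z)"
    using H by (auto intro!: derivative_eq_intros)
  then show ?thesis
    by (rule has_field_derivative_transform_within_open[OF _ open_ball assms(2)]) (simp add: eq)
qed

lemma integration_operator_0: "integration_operator n \<psi> g f 0 = 0"
  by (simp add: integration_operator_def)

lemma integration_operator_holo_disc:
  assumes "f holomorphic_on disc"
  shows "integration_operator n \<psi> g f \<in> holo_disc"
proof -
  have "integration_operator n \<psi> g f holomorphic_on disc"
    unfolding holomorphic_on_open[OF open_ball]
    using integration_operator_has_deriv[OF assms, of _ n] by blast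
  then show ?thesis by (simp add: holo_disc_def integration_operator_def)
qed

lemma integration_operator_add:
  assumes "f holomorphic_on disc" "h holomorphic_on disc"
  shows "integration_operator n \<psi> g (\<lambda>z. f z + h z)
    = (\<lambda>z. integration_operator n \<psi> g f z + integration_operator n \<psi> g h z)"
proof
  fix z
  show "integration_operator n \<psi> g (\<lambda>z. f z + h z) z = integration_operator n \<psi> g f z + integration_operator n \<psi> g h z"
  proof (cases "z \<in> disc")
    case True
    then have sub: "path_image (linepath 0 z) \<subseteq> disc"
      by (simp add: closed_segment_subset)
    have "((\<lambda>\<xi>. (deriv ^^ n) f (\<psi> \<xi>) * g \<xi> + (deriv ^^ n) h (\<psi> \<xi>) * g \<xi>) has_contour_integral
        (integration_operator n \<psi> g f z + integration_operator n \<psi> g h z)) (linepath 0 z)"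
      by (intro has_contour_integral_add has_contour_integral_integration_operator assms True)
    moreover have "(deriv ^^ n) f (\<psi> \<xi>) * g \<xi> + (deriv ^^ n) h (\<psi> \<xi>) * g \<xi>
        = (deriv ^^ n) (\<lambda>z. f z + h z) (\<psi> \<xi>) * g \<xi>" if "\<xi> \<in> path_image (linepath 0 z)" for \<xi>
      using higher_deriv_add[OF assms open_ball, of "\<psi> \<xi>" n] that sub \<psi>_disc[of \<xi>]
      by (auto simp: algebra_simps)
    ultimately have "((\<lambda>\<xi>. (deriv ^^ n) (\<lambda>z. f z + h z) (\<psi> \<xi>) * g \<xi>) has_contour_integral
        (integration_operator n \<psi> g f z + integration_operator n \<psi> g h z)) (linepath 0 z)"
      by (rule has_contour_integral_eq)
    with True show ?thesis by (simp add: integration_operator_def contour_integral_unique)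
  qed (auto simp: integration_operator_def)
qed

lemma integration_operator_cmult:
  assumes "f holomorphic_on disc"
  shows "integration_operator n \<psi> g (\<lambda>z. c * f z) = (\<lambda>z. c * integration_operator n \<psi> g f z)"
proof
  fix z
  show "integration_operator n \<psi> g (\<lambda>z. c * f z) z = c * integration_operator n \<psi> g f z"
  proof (cases "z \<in> disc")
    case True
    then have sub: "path_image (linepath 0 z) \<subseteq> disc"
      by (simp add: closed_segment_subset)
    have "((\<lambda>\<xi>. c * ((deriv ^^ n) f (\<psi> \<xi>) * g \<xi>)) has_contour_integral
        (c * integration_operator n \<psi> g f z)) (linepath 0 z)"
      by (intro has_contour_integral_lmul has_contour_integral_integration_operator assms True)
    moreover have "c * ((deriv ^^ n) f (\<psi> \<xi>) * g \<xi>) = (deriv ^^ n) (\<lambda>z. c * f z) (\<psi> \<xi>) * g \<xi>"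
      if "\<xi> \<in> path_image (linepath 0 z)" for \<xi>
      using higher_deriv_cmult[OF assms _ open_ball, of "\<psi> \<xi>" n c] that sub \<psi>_disc[of \<xi>]
      by (auto simp: algebra_simps)
    ultimately have "((\<lambda>\<xi>. (deriv ^^ n) (\<lambda>z. c * f z) (\<psi> \<xi>) * g \<xi>) has_contour_integral
        (c * integration_operator n \<psi> g f z)) (linepath 0 z)"
      by (rule has_contour_integral_eq)
    with True show ?thesis by (simp add: integration_operator_def contour_integral_unique)
  qed (auto simp: integration_operator_def)
qed

lemma linear_operator_integration_operator:
  assumes "X \<subseteq> holo_disc" "\<And>f. f \<in> X \<Longrightarrow> integration_operator n \<psi> g f \<in> Y"
  shows "linear_operator X Y (integration_operator n \<psi> g)"
  using assms integration_operator_add integration_operator_cmult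
  unfolding linear_operator_def holo_disc_def by blast

end

section \<open>Compactness of the operators with dilated self-map\<close>

lemma bloch_norm_le:
  assumes "u 0 = 0" "\<And>z. z \<in> disc \<Longrightarrow> ennreal (\<mu> (of_real (cmod z)) * cmod (deriv u z)) \<le> M"
  shows "bloch_norm \<mu> u \<le> M"
proof -
  have "(SUP z\<in>disc. ennreal (\<mu> (of_real (cmod z)) * cmod (deriv u z))) \<le> M"
    by (rule SUP_least) (rule assms(2))
  then show ?thesis by (simp add: bloch_norm_def assms(1))
qed

lemma bloch_norm_ge: "z \<in> disc \<Longrightarrow> ennreal (\<mu> (of_real (cmod z)) * cmod (deriv u z)) \<le> bloch_norm \<mu> u"
  unfolding bloch_norm_def by (rule add_increasing[OF zero_le SUP_upper])

text \<open>By Bolzano-Weierstrass it is enough that each infinite subset has a limit point, and the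
  limit of a convergent subsequence of distinct points is one.\<close>

lemma (in Metric_space) compactin_closure_of_convergent_subsequences:
  assumes "\<And>\<sigma>. range \<sigma> \<subseteq> S \<Longrightarrow> \<exists>l r. strict_mono (r :: nat \<Rightarrow> nat) \<and> limitin mtopology (\<sigma> \<circ> r) l sequentially"
  shows "compactin mtopology (mtopology closure_of S)"
  unfolding compact_closure_of_eq_Bolzano_Weierstrass
proof (intro allI impI)
  fix T assume T: "infinite T \<and> T \<subseteq> S \<and> T \<subseteq> M"
  then obtain \<sigma> :: "nat \<Rightarrow> 'a" where \<sigma>: "inj \<sigma>" "range \<sigma> \<subseteq> T"
    using infinite_countable_subset by metis
  then obtain l r where r: "strict_mono (r :: nat \<Rightarrow> nat)" and lim: "limitin mtopology (\<sigma> \<circ> r) l sequentially"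
    using assms[of \<sigma>] T by blast
  have l: "l \<in> M" using lim by (simp add: limitin_metric)
  have "l \<in> mtopology derived_set_of T"
    unfolding metric_derived_set_of
  proof (intro CollectI conjI allI impI l)
    fix e :: real assume "0 < e"
    with lim have "\<forall>\<^sub>F n in sequentially. (\<sigma> \<circ> r) n \<in> M \<and> d ((\<sigma> \<circ> r) n) l < e"
      by (simp add: limitin_metric)
    then obtain N where N: "\<And>n. N \<le> n \<Longrightarrow> \<sigma> (r n) \<in> M \<and> d (\<sigma> (r n)) l < e"
      by (auto simp: eventually_sequentially)
    \<comment> \<open>Of two consecutive terms at most one equals the limit, so one of them is a
      point of \<open>T\<close> near \<open>l\<close> and different from \<open>l\<close>.\<close>
    have "r N \<noteq> r (Suc N)" using strict_monoD[OF r, of N "Suc N"] by simp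
    then have ne: "\<sigma> (r N) \<noteq> \<sigma> (r (Suc N))" using \<sigma>(1) by (simp add: inj_eq)
    obtain k where k: "N \<le> k" "\<sigma> (r k) \<noteq> l"
    proof (cases "\<sigma> (r N) = l")
      case True
      with ne show ?thesis by (intro that[of "Suc N"]) auto
    qed (rule that[OF le_refl])
    have "\<sigma> (r k) \<in> mball l e"
      using N[OF k(1)] l by (simp add: in_mball commute[of l])
    moreover have "\<sigma> (r k) \<in> T" using \<sigma>(2) by blast
    ultimately show "\<exists>y\<in>T. y \<noteq> l \<and> y \<in> mball l e" using k(2) by blast
  qed
  then show "mtopology derived_set_of T \<noteq> {}" by blast
qed

lemma (in Metric_space) limitin_metricI:
  assumes "l \<in> M" "\<And>n. f n \<in> M" "\<And>\<epsilon>. 0 < \<epsilon> \<Longrightarrow> \<forall>\<^sub>F n in sequentially. d (f n) l < \<epsilon>"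
  shows "limitin mtopology f l sequentially"
  using assms by (simp add: limitin_metric)

context integration_setting
begin

lemma shrunk: "integration_setting \<mu> g (\<lambda>z. of_real r * \<psi> z)" if r: "0 \<le> r" "r < 1"
proof
  have "cmod (of_real r * \<psi> z) < 1" if "z \<in> disc" for z
    using \<psi>_disc[OF that] r mult_left_le_one_le[of "cmod (\<psi> z)" r] by (simp add: norm_mult)
  then show "self_map (\<lambda>z. of_real r * \<psi> z)"
    using self_map by (auto simp: self_map_def intro!: holomorphic_intros)
qed (rule weight g_holo)+

lemma shrunk_disc: "cmod (of_real r * \<psi> z) \<le> r" if "0 \<le> r" "z \<in> disc"
  using \<psi>_disc[OF that(2)] that(1) by (simp add: norm_mult mult_left_le)

lemma integration_operator_bloch_space:
  assumes f: "f holomorphic_on disc"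
    and M: "\<And>z. z \<in> disc \<Longrightarrow> \<mu> (of_real (cmod z)) * cmod ((deriv ^^ n) f (\<psi> z) * g z) \<le> M"
  shows "integration_operator n \<psi> g f \<in> bloch_space \<mu>"
proof -
  have "bloch_norm \<mu> (integration_operator n \<psi> g f) \<le> ennreal M"
    using M DERIV_imp_deriv[OF integration_operator_has_deriv[OF f]]
    by (intro bloch_norm_le) (auto simp: integration_operator_0 intro!: ennreal_leI)
  then have "bloch_norm \<mu> (integration_operator n \<psi> g f) < \<infinity>"
    by (metis ennreal_less_top infinity_ennreal_def order_le_less_trans)
  then show ?thesis
    using integration_operator_holo_disc[OF f] by (simp add: bloch_space_def)
qed

text \<open>The orders may differ because a Montel limit of \<open>n\<close>-th derivatives is fed
  to the operator of order 0; the self-maps differ when an operator is compared with its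
  dilation.\<close>

lemma deriv_integration_operator_diff:
  assumes "f holomorphic_on disc" "h holomorphic_on disc" "z \<in> disc" "integration_setting \<mu> g \<psi>'"
  shows "deriv (\<lambda>z. integration_operator n \<psi> g f z - integration_operator m \<psi>' g h z) z
    = ((deriv ^^ n) f (\<psi> z) - (deriv ^^ m) h (\<psi>' z)) * g z"
  unfolding left_diff_distrib
  by (intro DERIV_imp_deriv DERIV_diff integration_operator_has_deriv
      integration_setting.integration_operator_has_deriv[OF assms(4)] assms)

end

locale bounded_integration_setting = mixed_norm_setting + integration_setting +
  fixes n :: nat
  assumes bounded: "bounded_operator (mixed_space p q \<phi>) (mixed_norm p q \<phi>) (bloch_space \<mu>) (bloch_norm \<mu>)
    (integration_operator n \<psi> g)"
begin

text \<open>
  The image of the monomial of degree \<open>n\<close> has derivative \<open>n! g\<close>, so boundedness of the operator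
  bounds the product of weight and symbol.
\<close>

lemma weight_symbol_bound:
  obtains G where "0 \<le> G" "\<And>z. z \<in> disc \<Longrightarrow> \<mu> (of_real (cmod z)) * cmod (g z) \<le> G"
proof -
  let ?u = "integration_operator n \<psi> g (disc_power n)"
  have "disc_power n \<in> mixed_space p q \<phi>" by (rule disc_power_mixed_space)
  then have u: "?u \<in> bloch_space \<mu>" and holo: "disc_power n holomorphic_on disc"
    using bounded by (auto simp: bounded_operator_def linear_operator_def mixed_space_def holo_disc_def)
  define G where "G = enn2real (bloch_norm \<mu> ?u)"
  have "\<mu> (of_real (cmod z)) * cmod (g z) \<le> G" if z: "z \<in> disc" for z
  proof -
    have "(deriv ^^ n) (disc_power n) (\<psi> z) = (deriv ^^ n) (\<lambda>w. (w - 0) ^ n) (\<psi> z)"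
      using holo \<psi>_disc[OF z]
      by (intro higher_deriv_transform_within_open[of _ disc])
        (auto simp: disc_power_def intro!: holomorphic_intros)
    also have "\<dots> = fact n" by (subst higher_deriv_power) (simp add: pochhammer_fact)
    finally have d: "deriv ?u z = fact n * g z"
      using DERIV_imp_deriv[OF integration_operator_has_deriv[OF holo z, of n]] by simp
    have "\<mu> (of_real (cmod z)) * (1 * cmod (g z)) \<le> \<mu> (of_real (cmod z)) * (fact n * cmod (g z))"
      using \<mu>_pos[OF z] by (intro mult_left_mono mult_right_mono) auto
    also have "\<dots> = \<mu> (of_real (cmod z)) * cmod (deriv ?u z)"
      by (simp add: d norm_mult)
    finally have "ennreal (\<mu> (of_real (cmod z)) * cmod (g z)) \<le> bloch_norm \<mu> ?u"
      using order_trans[OF ennreal_leI bloch_norm_ge[OF z]] by simp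
    from enn2real_mono[OF this] show ?thesis
      using u \<mu>_pos[OF z] by (simp add: G_def bloch_space_def)
  qed
  then show ?thesis by (intro that[of G]) (auto simp: G_def)
qed

text \<open>The dilated map takes values in the closed disc of radius \<open>r\<close>, where a
  subsequence of the \<open>n\<close>-th derivatives converges uniformly. Multiplication by the
  bounded quantity \<open>\<mu> * cmod g\<close> turns this into convergence in the Bloch
  norm.\<close>

lemma compact_operator_shrunk:
  assumes r: "0 \<le> r" "r < 1"
  shows "compact_operator (mixed_space p q \<phi>) (mixed_norm p q \<phi>) (bloch_space \<mu>) (bloch_norm \<mu>)
    (integration_operator n (\<lambda>z. of_real r * \<psi> z) g)"
proof -
  interpret S: integration_setting \<mu> g "\<lambda>z. of_real r * \<psi> z" by (rule shrunk[OF r])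
  interpret M: Metric_space "bloch_space \<mu>" "\<lambda>f h. enn2real (bloch_norm \<mu> (\<lambda>z. f z - h z))"
    by (rule Metric_space_bloch[OF weight])
  let ?T = "integration_operator n (\<lambda>z. of_real r * \<psi> z) g"
  obtain G where G: "0 \<le> G" "\<And>z. z \<in> disc \<Longrightarrow> \<mu> (of_real (cmod z)) * cmod (g z) \<le> G"
    using weight_symbol_bound by blast
  obtain C where C: "0 < C"
    "\<And>f K w. f holomorphic_on disc \<Longrightarrow> 0 \<le> K \<Longrightarrow> mixed_norm p q \<phi> f \<le> ennreal K \<Longrightarrow> cmod w < 1 \<Longrightarrow>
       cmod ((deriv ^^ n) f w) * growth n (cmod w) \<le> C * K"
    using higher_deriv_estimate by blast
  have local: "cmod ((deriv ^^ n) f w) \<le> C * K / growth n d"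
    if "f holomorphic_on disc" "0 \<le> K" "mixed_norm p q \<phi> f \<le> ennreal K" "cmod w \<le> d" "d < 1" for f K w d
  proof -
    have d: "0 \<le> d" using that(4) norm_ge_zero[of w] by linarith
    have "cmod ((deriv ^^ n) f w) * growth n d \<le> cmod ((deriv ^^ n) f w) * growth n (cmod w)"
      using growth_antimono[of "cmod w" d n] that by (intro mult_left_mono) auto
    also have "\<dots> \<le> C * K" using that by (intro C) auto
    finally show ?thesis using growth_pos[OF d that(5), of n] by (simp add: field_simps)
  qed
  have scale: "\<mu> (of_real (cmod z)) * cmod (v * g z) \<le> A * G" if "z \<in> disc" "cmod v \<le> A" for z v A
  proof -
    have "cmod v * (\<mu> (of_real (cmod z)) * cmod (g z)) \<le> A * G"
      using that G \<mu>_pos[OF that(1)] order_trans[OF norm_ge_zero that(2)] by (intro mult_mono) auto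
    then show ?thesis by (simp add: norm_mult mult_ac)
  qed
  have T_bloch: "?T f \<in> bloch_space \<mu>" if f: "f \<in> mixed_space p q \<phi>" for f
  proof (rule S.integration_operator_bloch_space)
    show holo: "f holomorphic_on disc" using f by (simp add: mixed_space_def holo_disc_def)
    fix z assume z: "z \<in> disc"
    have "mixed_norm p q \<phi> f \<le> ennreal (enn2real (mixed_norm p q \<phi> f))"
      using f by (simp add: mixed_space_def)
    from local[OF holo enn2real_nonneg this shrunk_disc[OF r(1) z] r(2)]
    show "\<mu> (of_real (cmod z)) * cmod ((deriv ^^ n) f (of_real r * \<psi> z) * g z)
      \<le> C * enn2real (mixed_norm p q \<phi> f) / growth n r * G"
      by (intro scale z)
  qed
  have lin: "linear_operator (mixed_space p q \<phi>) (bloch_space \<mu>) ?T"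
    using T_bloch by (intro S.linear_operator_integration_operator) (auto simp: mixed_space_def)
  have "compactin M.mtopology (M.mtopology closure_of (?T ` B))"
    if B: "B \<subseteq> mixed_space p q \<phi>" and K: "\<forall>f\<in>B. mixed_norm p q \<phi> f \<le> ennreal K" for B K
  proof (rule M.compactin_closure_of_convergent_subsequences)
    fix \<sigma> :: "nat \<Rightarrow> complex \<Rightarrow> complex" assume "range \<sigma> \<subseteq> ?T ` B"
    then have "\<forall>k. \<exists>f\<in>B. \<sigma> k = ?T f" by blast
    then obtain f where f: "\<And>k. f k \<in> B" "\<And>k. \<sigma> k = ?T (f k)" by metis
    have fh: "h holomorphic_on disc" if "h \<in> B" for h
      using that B by (auto simp: mixed_space_def holo_disc_def)
    \<comment> \<open>A negative \<open>K\<close> is allowed in the definition of compactness, where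
      \<open>ennreal\<close> reads it as 0.\<close>
    have fK: "mixed_norm p q \<phi> h \<le> ennreal (max K 0)" if "h \<in> B" for h
    proof -
      have "ennreal (max K 0) = ennreal K" by (simp add: max_def ennreal_neg)
      then show ?thesis using K that by simp
    qed
    obtain h s where h: "h holomorphic_on disc" and s: "strict_mono (s :: nat \<Rightarrow> nat)"
      and u: "\<And>Q. compact Q \<Longrightarrow> Q \<subseteq> disc \<Longrightarrow> uniform_limit Q ((\<lambda>k. (deriv ^^ n) (f k)) \<circ> s) h sequentially"
    proof (rule Montel[of disc "(deriv ^^ n) ` B" "\<lambda>k. (deriv ^^ n) (f k)"])
      show "\<exists>A. \<forall>h\<in>(deriv ^^ n) ` B. \<forall>z\<in>Q. cmod (h z) \<le> A" if Q: "compact Q" "Q \<subseteq> disc" for Q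
      proof -
        obtain d where d: "d < 1" "\<And>z. z \<in> Q \<Longrightarrow> cmod z \<le> d"
        proof (cases "Q = {}")
          case False
          then obtain x where "x \<in> Q" "\<And>y. y \<in> Q \<Longrightarrow> cmod y \<le> cmod x"
            using continuous_attains_sup[OF Q(1), of cmod] continuous_on_norm_id by blast
          then show ?thesis using that[of "cmod x"] Q(2) by auto
        qed (use that[of 0] in auto)
        show ?thesis
        proof (intro exI ballI)
          fix h z assume "h \<in> (deriv ^^ n) ` B" and z: "z \<in> Q"
          then obtain f' where f': "f' \<in> B" "h = (deriv ^^ n) f'" by blast
          show "cmod (h z) \<le> C * max K 0 / growth n d"
            unfolding f'(2) by (rule local) (use f' fh fK d z in auto)
        qed
      qed
    qed (use fh f in \<open>auto intro!: holomorphic_higher_deriv\<close>)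
    \<comment> \<open>Order 0, since \<open>h\<close> is already a limit of \<open>n\<close>-th
      derivatives; no \<open>n\<close>-fold primitive of \<open>h\<close> in the mixed norm space
      has to be found.\<close>
    let ?l = "integration_operator 0 (\<lambda>z. of_real r * \<psi> z) g h"
    have sub: "cball (0::complex) r \<subseteq> disc" using r by auto
    then have "continuous_on (cball 0 r) h"
      by (intro holomorphic_on_imp_continuous_on holomorphic_on_subset[OF h])
    then have "compact (h ` cball 0 r)" by (intro compact_continuous_image compact_cball)
    then obtain A where A: "\<And>w. w \<in> cball 0 r \<Longrightarrow> cmod (h w) \<le> A"
      using compact_imp_bounded[of "h ` cball 0 r"] unfolding bounded_iff by blast
    have l: "?l \<in> bloch_space \<mu>"
    proof (rule S.integration_operator_bloch_space[OF h])
      fix z assume z: "z \<in> disc"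
      have "cmod (h (of_real r * \<psi> z)) \<le> A" using shrunk_disc[OF r(1) z] by (intro A) simp
      then show "\<mu> (of_real (cmod z)) * cmod ((deriv ^^ 0) h (of_real r * \<psi> z) * g z) \<le> A * G"
        unfolding funpow_0 by (intro scale z)
    qed
    have "limitin M.mtopology (\<sigma> \<circ> s) ?l sequentially"
    proof (rule M.limitin_metricI[OF l])
      show "(\<sigma> \<circ> s) k \<in> bloch_space \<mu>" for k
        using T_bloch f B by auto
      fix \<epsilon> :: real assume \<epsilon>: "0 < \<epsilon>"
      define \<eta> where "\<eta> = \<epsilon> / (2 * (G + 1))"
      have \<eta>: "0 < \<eta>" "\<eta> * G < \<epsilon>"
      proof -
        show "0 < \<eta>" using \<epsilon> G(1) by (simp add: \<eta>_def)
        have "\<epsilon> * G < \<epsilon> * (2 * (G + 1))" using \<epsilon> G(1) by (intro mult_strict_left_mono) auto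
        then show "\<eta> * G < \<epsilon>" using G(1) by (simp add: \<eta>_def divide_less_eq)
      qed
      have "\<forall>\<^sub>F k in sequentially. \<forall>w\<in>cball 0 r. dist ((deriv ^^ n) (f (s k)) w) (h w) < \<eta>"
        using uniform_limitD[OF u[OF compact_cball sub] \<eta>(1)] unfolding o_def .
      then show "\<forall>\<^sub>F k in sequentially. enn2real (bloch_norm \<mu> (\<lambda>z. (\<sigma> \<circ> s) k z - ?l z)) < \<epsilon>"
      proof eventually_elim
        fix k assume k: "\<forall>w\<in>cball 0 r. dist ((deriv ^^ n) (f (s k)) w) (h w) < \<eta>"
        have "bloch_norm \<mu> (\<lambda>z. ?T (f (s k)) z - ?l z) \<le> ennreal (\<eta> * G)"
        proof (rule bloch_norm_le)
          fix z assume z: "z \<in> disc"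
          have "cmod ((deriv ^^ n) (f (s k)) (of_real r * \<psi> z) - h (of_real r * \<psi> z)) \<le> \<eta>"
            using bspec[OF k, of "of_real r * \<psi> z"] shrunk_disc[OF r(1) z] by (simp add: dist_norm)
          then show "ennreal (\<mu> (of_real (cmod z)) * cmod (deriv (\<lambda>z. ?T (f (s k)) z - ?l z) z)) \<le> ennreal (\<eta> * G)"
            unfolding S.deriv_integration_operator_diff[OF fh[OF f(1)] h z S.integration_setting_axioms] funpow_0
            by (intro ennreal_leI scale z)
        qed (simp add: integration_operator_def)
        then have "enn2real (bloch_norm \<mu> (\<lambda>z. ?T (f (s k)) z - ?l z)) \<le> enn2real (ennreal (\<eta> * G))"
          by (intro enn2real_mono) auto
        also have "\<dots> < \<epsilon>" using \<eta> G by simp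
        finally show "enn2real (bloch_norm \<mu> (\<lambda>z. (\<sigma> \<circ> s) k z - ?l z)) < \<epsilon>" by (simp add: f)
      qed
    qed
    with s show "\<exists>l r. strict_mono (r :: nat \<Rightarrow> nat) \<and> limitin M.mtopology (\<sigma> \<circ> r) l sequentially" by blast
  qed
  with lin show ?thesis by (simp add: compact_operator_def norm_topology_def)
qed

end

section \<open>Bounds for the essential norm\<close>

lemma tendsto_at_left_INF:
  fixes S :: "real \<Rightarrow> ennreal"
  assumes "antimono S"
  shows "(S \<longlongrightarrow> (INF \<delta>\<in>{..<1}. S \<delta>)) (at_left 1)"
proof (rule order_tendstoI)
  fix x assume "x < (INF \<delta>\<in>{..<1}. S \<delta>)"
  then have "\<And>\<delta>. \<delta> < 1 \<Longrightarrow> x < S \<delta>" by (rule less_le_trans) (simp add: INF_lower)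
  then show "\<forall>\<^sub>F \<delta> in at_left 1. x < S \<delta>"
    by (auto simp: eventually_at_left_field intro!: exI[of _ 0])
next
  fix x assume "(INF \<delta>\<in>{..<1}. S \<delta>) < x"
  then obtain \<epsilon> where \<epsilon>: "\<epsilon> < 1" "S \<epsilon> < x" by (auto simp: INF_less_iff)
  then show "\<forall>\<^sub>F \<delta> in at_left 1. S \<delta> < x"
    using antimonoD[OF assms] unfolding eventually_at_left_field
    by (intro exI[of _ \<epsilon>]) (metis less_imp_le order_le_less_trans)
qed

text \<open>\<open>Lim\<close> says something only once the limit is known to exist. The suprema
  decrease as the threshold grows, so the limit is their infimum.\<close>

lemma boundary_limsup:
  fixes S :: "real \<Rightarrow> ennreal" and \<psi> :: "complex \<Rightarrow> complex" and F :: "complex \<Rightarrow> real"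
  defines "S \<equiv> \<lambda>\<delta>. SUP z\<in>{z \<in> disc. \<delta> < cmod (\<psi> z) \<and> cmod (\<psi> z) < 1}. ennreal (F z)"
  shows "(S \<longlongrightarrow> boundary_limsup \<psi> F) (at_left 1)" "\<And>\<delta>. \<delta> < 1 \<Longrightarrow> boundary_limsup \<psi> F \<le> S \<delta>"
proof -
  have "antimono S" unfolding S_def by (intro antimonoI SUP_subset_mono) auto
  from tendsto_at_left_INF[OF this] have *: "(S \<longlongrightarrow> (INF \<delta>\<in>{..<1}. S \<delta>)) (at_left 1)" .
  have "boundary_limsup \<psi> F = (INF \<delta>\<in>{..<1}. S \<delta>)"
    unfolding boundary_limsup_def using tendsto_Lim[OF trivial_limit_at_left_real *] by (simp add: S_def)
  with * show "(S \<longlongrightarrow> boundary_limsup \<psi> F) (at_left 1)"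
    and "\<And>\<delta>. \<delta> < 1 \<Longrightarrow> boundary_limsup \<psi> F \<le> S \<delta>"
    by (auto intro: INF_lower)
qed

context mixed_norm_setting
begin

text \<open>Chosen before \<open>\<mu>\<close>, \<open>g\<close> and \<open>\<psi>\<close> are
  fixed, hence uniform in them. The dependence on the order is explicit because orders
  \<open>n\<close> and \<open>Suc n\<close> are both used.\<close>

definition upper_const :: "nat \<Rightarrow> real" where
  "upper_const n = (SOME C. 0 < C \<and>
    (\<forall>f K w. f holomorphic_on disc \<longrightarrow> 0 \<le> K \<longrightarrow> mixed_norm p q \<phi> f \<le> ennreal K \<longrightarrow> cmod w < 1 \<longrightarrow>
       cmod ((deriv ^^ n) f w) * growth n (cmod w) \<le> C * K))"

lemma upper_const:
  shows upper_const_pos: "0 < upper_const n"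
    and higher_deriv_le_upper_const:
      "\<And>f K w. f holomorphic_on disc \<Longrightarrow> 0 \<le> K \<Longrightarrow> mixed_norm p q \<phi> f \<le> ennreal K \<Longrightarrow> cmod w < 1 \<Longrightarrow>
       cmod ((deriv ^^ n) f w) * growth n (cmod w) \<le> upper_const n * K"
proof -
  have "\<exists>C. 0 < C \<and>
    (\<forall>f K w. f holomorphic_on disc \<longrightarrow> 0 \<le> K \<longrightarrow> mixed_norm p q \<phi> f \<le> ennreal K \<longrightarrow> cmod w < 1 \<longrightarrow>
       cmod ((deriv ^^ n) f w) * growth n (cmod w) \<le> C * K)"
    using higher_deriv_estimate[of n] by metis
  from someI_ex[OF this, folded upper_const_def]
  show "0 < upper_const n" and "\<And>f K w. f holomorphic_on disc \<Longrightarrow> 0 \<le> K \<Longrightarrow> mixed_norm p q \<phi> f \<le> ennreal K \<Longrightarrow> cmod w < 1 \<Longrightarrow>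
       cmod ((deriv ^^ n) f w) * growth n (cmod w) \<le> upper_const n * K"
    by blast+
qed

end

section \<open>The upper bound by approximation with dilated operators\<close>

context bounded_integration_setting
begin

definition ratio :: "complex \<Rightarrow> real" where
  "ratio z = \<mu> (of_real (cmod z)) * cmod (g z) / growth n (cmod (\<psi> z))"

lemma ratio_nonneg: "0 \<le> ratio z" if "z \<in> disc"
  using \<mu>_pos[OF that] growth_pos[OF norm_ge_zero \<psi>_disc[OF that], of n] by (simp add: ratio_def)

abbreviation ess :: ennreal where
  "ess \<equiv> essential_norm (mixed_space p q \<phi>) (mixed_norm p q \<phi>) (bloch_space \<mu>) (bloch_norm \<mu>)
    (integration_operator n \<psi> g)"

abbreviation tail_sup :: "real \<Rightarrow> ennreal" where
  "tail_sup \<delta> \<equiv> SUP z\<in>{z \<in> disc. \<delta> < cmod (\<psi> z) \<and> cmod (\<psi> z) < 1}. ennreal (ratio z)"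

text \<open>Since \<open>growth\<close> decreases, the value at \<open>r * \<psi> z\<close> obeys
  the bound valid at \<open>\<psi> z\<close>; the 2 counts the two terms.\<close>

lemma shrunk_diff_near_boundary:
  assumes f: "f holomorphic_on disc" "mixed_norm p q \<phi> f \<le> 1" and r: "0 \<le> r" "r < 1" and z: "z \<in> disc"
  shows "\<mu> (of_real (cmod z)) * cmod (((deriv ^^ n) f (\<psi> z) - (deriv ^^ n) f (of_real r * \<psi> z)) * g z)
    \<le> 2 * upper_const n * ratio z"
proof -
  let ?\<rho> = "cmod (\<psi> z)"
  have \<rho>: "0 \<le> ?\<rho>" "?\<rho> < 1" using \<psi>_disc[OF z] by auto
  have r\<rho>: "0 \<le> r * ?\<rho>" "r * ?\<rho> \<le> ?\<rho>" using r \<rho> by (auto intro: mult_left_le_one_le)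
  have gr: "0 < growth n ?\<rho>" using growth_pos[OF \<rho>] .
  have 1: "cmod ((deriv ^^ n) f (\<psi> z)) * growth n ?\<rho> \<le> upper_const n"
    using higher_deriv_le_upper_const[OF f(1), of 1 "\<psi> z" n] f(2) \<rho> by simp
  have "cmod ((deriv ^^ n) f (of_real r * \<psi> z)) * growth n ?\<rho>
      \<le> cmod ((deriv ^^ n) f (of_real r * \<psi> z)) * growth n (r * ?\<rho>)"
    using growth_antimono[OF r\<rho> \<rho>(2)] by (intro mult_left_mono) auto
  also have "\<dots> \<le> upper_const n"
    using higher_deriv_le_upper_const[OF f(1), of 1 "of_real r * \<psi> z" n] f(2) \<rho> r\<rho> r
    by (simp add: norm_mult)
  finally have "(cmod ((deriv ^^ n) f (\<psi> z)) + cmod ((deriv ^^ n) f (of_real r * \<psi> z))) * growth n ?\<rho>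
      \<le> 2 * upper_const n"
    using 1 by (simp add: distrib_right)
  then have "cmod ((deriv ^^ n) f (\<psi> z)) + cmod ((deriv ^^ n) f (of_real r * \<psi> z))
      \<le> 2 * upper_const n / growth n ?\<rho>"
    using gr by (simp add: pos_le_divide_eq)
  then have d: "cmod ((deriv ^^ n) f (\<psi> z) - (deriv ^^ n) f (of_real r * \<psi> z)) \<le> 2 * upper_const n / growth n ?\<rho>"
    by (rule order_trans[OF norm_triangle_ineq4])
  have "\<mu> (of_real (cmod z)) * (cmod ((deriv ^^ n) f (\<psi> z) - (deriv ^^ n) f (of_real r * \<psi> z)) * cmod (g z))
    \<le> \<mu> (of_real (cmod z)) * (2 * upper_const n / growth n ?\<rho> * cmod (g z))"
    using d \<mu>_pos[OF z] by (intro mult_left_mono mult_right_mono) auto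
  then show ?thesis by (simp add: ratio_def norm_mult mult_ac)
qed

text \<open>Mean value estimate on the convex set \<open>cball 0 \<delta>\<close>, with the growth
  estimate for order \<open>n + 1\<close> bounding the derivative; the points
  \<open>\<psi> z\<close> and \<open>r * \<psi> z\<close> are at distance at most
  \<open>1 - r\<close>.\<close>

lemma shrunk_diff_interior:
  assumes f: "f holomorphic_on disc" "mixed_norm p q \<phi> f \<le> 1" and r: "0 \<le> r" "r < 1" and z: "z \<in> disc"
    and \<delta>: "cmod (\<psi> z) \<le> \<delta>" "\<delta> < 1"
  shows "cmod ((deriv ^^ n) f (\<psi> z) - (deriv ^^ n) f (of_real r * \<psi> z))
    \<le> upper_const (Suc n) / growth (Suc n) \<delta> * (1 - r)"
proof -
  have \<delta>0: "0 \<le> \<delta>" using \<delta>(1) norm_ge_zero[of "\<psi> z"] by linarith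
  have holo: "(deriv ^^ n) f holomorphic_on disc" by (intro holomorphic_higher_deriv f open_ball)
  have "cmod ((deriv ^^ n) f (\<psi> z) - (deriv ^^ n) f (of_real r * \<psi> z))
    \<le> upper_const (Suc n) / growth (Suc n) \<delta> * cmod (\<psi> z - of_real r * \<psi> z)"
  proof (rule field_differentiable_bound[of "cball 0 \<delta>"])
    fix w :: complex assume w: "w \<in> cball 0 \<delta>"
    then have w1: "w \<in> disc" "cmod w \<le> \<delta>" using \<delta> by auto
    show "((deriv ^^ n) f has_field_derivative (deriv ^^ Suc n) f w) (at w within cball 0 \<delta>)"
      using holomorphic_derivI[OF holo open_ball w1(1)] by (simp add: has_field_derivative_at_within)
    have "cmod ((deriv ^^ Suc n) f w) * growth (Suc n) \<delta> \<le> cmod ((deriv ^^ Suc n) f w) * growth (Suc n) (cmod w)"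
      using growth_antimono[OF norm_ge_zero w1(2) \<delta>(2)] by (intro mult_left_mono) auto
    also have "\<dots> \<le> upper_const (Suc n)"
      using higher_deriv_le_upper_const[OF f(1), of 1 w "Suc n"] f(2) w1 by simp
    finally show "cmod ((deriv ^^ Suc n) f w) \<le> upper_const (Suc n) / growth (Suc n) \<delta>"
      using growth_pos[OF \<delta>0 \<delta>(2), of "Suc n"] by (simp add: pos_le_divide_eq)
  next
    have "r * cmod (\<psi> z) \<le> cmod (\<psi> z)" using r by (intro mult_left_le_one_le) auto
    then show "of_real r * \<psi> z \<in> cball 0 \<delta>" using \<delta> r by (simp add: norm_mult)
  qed (use \<delta> in auto)
  also have "cmod (\<psi> z - of_real r * \<psi> z) = (1 - r) * cmod (\<psi> z)"
  proof -
    have "\<psi> z - of_real r * \<psi> z = of_real (1 - r) * \<psi> z" by (simp add: algebra_simps)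
    then show ?thesis using r by (simp only: norm_mult norm_of_real)
  qed
  also have "upper_const (Suc n) / growth (Suc n) \<delta> * ((1 - r) * cmod (\<psi> z))
      \<le> upper_const (Suc n) / growth (Suc n) \<delta> * (1 - r)"
    using r \<psi>_disc[OF z] upper_const_pos[of "Suc n"] growth_pos[OF \<delta>0 \<delta>(2), of "Suc n"]
    by (intro mult_left_mono mult_left_le) auto
  finally show ?thesis .
qed

lemma essential_norm_le_tail:
  assumes \<delta>: "0 \<le> \<delta>" "\<delta> < 1"
  shows "ess \<le> ennreal (2 * upper_const n) * tail_sup \<delta>"
proof (rule ennreal_le_epsilon)
  fix e :: real assume e: "0 < e"
  obtain G where G: "0 \<le> G" "\<And>z. z \<in> disc \<Longrightarrow> \<mu> (of_real (cmod z)) * cmod (g z) \<le> G"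
    using weight_symbol_bound by blast
  define A where "A = upper_const (Suc n) / growth (Suc n) \<delta> * G"
  have A: "0 \<le> A"
    using G(1) upper_const_pos[of "Suc n"] growth_pos[OF \<delta>, of "Suc n"] by (simp add: A_def)
  \<comment> \<open>The minimum keeps \<open>r\<close> nonnegative, and \<open>A + 1\<close> avoids
    division by zero; the interior error \<open>A * (1 - r)\<close> is then at most
    \<open>e\<close>.\<close>
  define r where "r = 1 - min 1 (e / (A + 1))"
  have r: "0 \<le> r" "r < 1" using e A by (auto simp: r_def)
  have Ar: "A * (1 - r) \<le> e"
  proof -
    have "A * (1 - r) \<le> A * (e / (A + 1))" using A by (intro mult_left_mono) (auto simp: r_def)
    also have "\<dots> \<le> e" using A e by (simp add: field_simps)
    finally show ?thesis .
  qed
  let ?T = "integration_operator n \<psi> g" and ?S = "integration_operator n (\<lambda>z. of_real r * \<psi> z) g"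
  have "ess \<le> op_norm (mixed_space p q \<phi>) (mixed_norm p q \<phi>) (bloch_norm \<mu>) (\<lambda>f z. ?T f z - ?S f z)"
    unfolding essential_norm_def using compact_operator_shrunk[OF r] by (intro INF_lower) simp
  also have "\<dots> \<le> ennreal (2 * upper_const n) * tail_sup \<delta> + ennreal e"
    unfolding op_norm_def
  proof (rule SUP_least)
    fix f assume "f \<in> {f \<in> mixed_space p q \<phi>. mixed_norm p q \<phi> f \<le> 1}"
    then have f: "f holomorphic_on disc" "mixed_norm p q \<phi> f \<le> 1" by (auto simp: mixed_space_def holo_disc_def)
    show "bloch_norm \<mu> (\<lambda>z. ?T f z - ?S f z) \<le> ennreal (2 * upper_const n) * tail_sup \<delta> + ennreal e"
    proof (rule bloch_norm_le)
      show "?T f 0 - ?S f 0 = 0" by (simp add: integration_operator_def)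
      fix z assume z: "z \<in> disc"
      let ?D = "(deriv ^^ n) f (\<psi> z) - (deriv ^^ n) f (of_real r * \<psi> z)"
      have d: "deriv (\<lambda>z. ?T f z - ?S f z) z = ?D * g z"
        by (rule deriv_integration_operator_diff[OF f(1) f(1) z shrunk[OF r]])
      show "ennreal (\<mu> (of_real (cmod z)) * cmod (deriv (\<lambda>z. ?T f z - ?S f z) z))
          \<le> ennreal (2 * upper_const n) * tail_sup \<delta> + ennreal e"
        unfolding d
      proof (cases "cmod (\<psi> z) \<le> \<delta>")
        case True
        have "\<mu> (of_real (cmod z)) * cmod (?D * g z) = cmod ?D * (\<mu> (of_real (cmod z)) * cmod (g z))"
          by (simp add: norm_mult)
        also have "\<dots> \<le> upper_const (Suc n) / growth (Suc n) \<delta> * (1 - r) * G"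
          using shrunk_diff_interior[OF f r z True \<delta>(2)] G(2)[OF z] \<mu>_pos[OF z]
            upper_const_pos[of "Suc n"] growth_pos[OF \<delta>, of "Suc n"] r
          by (intro mult_mono) auto
        also have "\<dots> = A * (1 - r)" by (simp add: A_def)
        finally have "ennreal (\<mu> (of_real (cmod z)) * cmod (?D * g z)) \<le> ennreal e"
          using Ar by (intro ennreal_leI) linarith
        then show "ennreal (\<mu> (of_real (cmod z)) * cmod (?D * g z))
            \<le> ennreal (2 * upper_const n) * tail_sup \<delta> + ennreal e"
          by (rule add_increasing[OF zero_le])
      next
        case False
        have "ennreal (\<mu> (of_real (cmod z)) * cmod (?D * g z)) \<le> ennreal (2 * upper_const n * ratio z)"
          by (intro ennreal_leI shrunk_diff_near_boundary f r z)
        also have "\<dots> = ennreal (2 * upper_const n) * ennreal (ratio z)"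
          using upper_const_pos[of n] by (intro ennreal_mult ratio_nonneg z) auto
        also have "\<dots> \<le> ennreal (2 * upper_const n) * tail_sup \<delta>"
          using False z \<psi>_disc[OF z] by (intro mult_left_mono SUP_upper) auto
        finally show "ennreal (\<mu> (of_real (cmod z)) * cmod (?D * g z))
            \<le> ennreal (2 * upper_const n) * tail_sup \<delta> + ennreal e"
          by (rule add_increasing2[OF zero_le])
      qed
    qed
  qed
  finally show "ess \<le> ennreal (2 * upper_const n) * tail_sup \<delta> + ennreal e" .
qed

lemma essential_norm_upper: "ess \<le> ennreal (2 * upper_const n) * boundary_limsup \<psi> ratio"
proof (rule tendsto_lowerbound)
  show "((\<lambda>\<delta>. ennreal (2 * upper_const n) * tail_sup \<delta>)
      \<longlongrightarrow> ennreal (2 * upper_const n) * boundary_limsup \<psi> ratio) (at_left 1)"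
    by (intro ennreal_tendsto_cmult boundary_limsup(1)) simp
  show "\<forall>\<^sub>F \<delta> in at_left 1. ess \<le> ennreal (2 * upper_const n) * tail_sup \<delta>"
    unfolding eventually_at_left_field
    by (intro exI[of _ 0] conjI allI impI essential_norm_le_tail) auto
qed simp

section \<open>The lower bound from differences of test functions\<close>

definition lower_const :: real where
  "lower_const = (1 / 2) ^ n / test_bound"

lemma lower_const_pos: "0 < lower_const"
  using test_bound_pos by (simp add: lower_const_def)

text \<open>
  A bounded sequence tending to 0 locally uniformly need not tend to 0 weakly in
  \<open>H(p, q, \<phi>)\<close> (think of small \<open>p\<close> or \<open>q\<close>), so a compact operator need not map the test functions to
  a null sequence. It does map a subsequence to a Cauchy sequence, and differences of two test
  functions are just as good: the second one is negligible near the point where the first one is large.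
\<close>

lemma op_norm_compact_perturbation_lower:
  assumes S: "compact_operator (mixed_space p q \<phi>) (mixed_norm p q \<phi>) (bloch_space \<mu>) (bloch_norm \<mu>) S"
    and l: "0 \<le> l" "ennreal l < boundary_limsup \<psi> ratio"
  shows "ennreal (lower_const * l)
    \<le> op_norm (mixed_space p q \<phi>) (mixed_norm p q \<phi>) (bloch_norm \<mu>) (\<lambda>f z. integration_operator n \<psi> g f z - S f z)"
    (is "_ \<le> ?N")
proof (rule ennreal_le_epsilon)
  fix e :: real assume e: "0 < e"
  interpret M: Metric_space "bloch_space \<mu>" "\<lambda>f h. enn2real (bloch_norm \<mu> (\<lambda>z. f z - h z))"
    by (rule Metric_space_bloch[OF weight])
  let ?T = "integration_operator n \<psi> g"
  obtain G where G: "0 \<le> G" "\<And>z. z \<in> disc \<Longrightarrow> \<mu> (of_real (cmod z)) * cmod (g z) \<le> G"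
    using weight_symbol_bound by blast
  \<comment> \<open>The shift by 2 makes every threshold at least \<open>1 / 2\<close>, as the lower
    derivative bound requires.\<close>
  have "\<exists>z\<in>disc. 1 - 1 / real (k + 2) < cmod (\<psi> z) \<and> l < ratio z" for k :: nat
  proof -
    have "ennreal l < tail_sup (1 - 1 / real (k + 2))"
      using l(2) boundary_limsup(2)[of "1 - 1 / real (k + 2)" \<psi> ratio] by (simp add: less_le_trans)
    then obtain z where "z \<in> disc" "1 - 1 / real (k + 2) < cmod (\<psi> z)" "ennreal l < ennreal (ratio z)"
      by (auto simp: less_SUP_iff)
    then show ?thesis using l(1) by (auto simp: ennreal_less_iff)
  qed
  then obtain z where z: "\<And>k. z k \<in> disc" "\<And>k. 1 - 1 / real (k + 2) < cmod (\<psi> (z k))" "\<And>k. l < ratio (z k)"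
    by metis
  define w where "w = (\<lambda>k. \<psi> (z k))"
  have w1: "cmod (w k) < 1" for k using \<psi>_disc[OF z(1)] by (simp add: w_def)
  have w2: "1 / 2 \<le> cmod (w k)" for k
  proof -
    have "1 / real (k + 2) \<le> 1 / 2" by (intro divide_left_mono) auto
    then show ?thesis using z(2)[of k] unfolding w_def by linarith
  qed
  have wlim: "(\<lambda>k. cmod (w k)) \<longlonglongrightarrow> 1"
  proof (rule tendsto_sandwich[of "\<lambda>k. 1 - 1 / real (k + 2)" _ _ "\<lambda>_. 1"])
    have "(\<lambda>k. 1 - 1 / real (k + 2)) \<longlonglongrightarrow> 1 - 0"
      by (intro tendsto_intros LIMSEQ_ignore_initial_segment[OF lim_1_over_n])
    then show "(\<lambda>k. 1 - 1 / real (k + 2)) \<longlonglongrightarrow> 1" by simp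
  qed (use z(2) w1 in \<open>auto simp: w_def less_imp_le intro!: always_eventually\<close>)
  define c where "c = complex_of_real (1 / test_bound)"
  have c: "cmod c = 1 / test_bound" using test_bound_pos by (simp add: c_def norm_divide)
  define t where "t = (\<lambda>k u. c * test_fun (w k) u)"
  have t_holo: "t k holomorphic_on disc" for k
    using test_fun_holo_disc[OF w1, of k] by (auto simp: t_def holo_disc_def intro!: holomorphic_intros)
  have t_norm: "mixed_norm p q \<phi> (t k) \<le> ennreal (cmod c * 2 powr gap * profile_norm)" for k
    unfolding t_def by (rule mixed_norm_test_fun[OF w1])
  have t_mem: "(\<lambda>u. v * t k u) \<in> mixed_space p q \<phi>" for k v
  proof -
    have "mixed_norm p q \<phi> (\<lambda>u. (v * c) * test_fun (w k) u) < \<infinity>"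
      using mixed_norm_test_fun[OF w1] by (metis ennreal_less_top infinity_ennreal_def order_le_less_trans)
    then show ?thesis
      using test_fun_holo_disc[OF w1, of k]
      by (auto simp: mixed_space_def t_def holo_disc_def mult.assoc intro!: holomorphic_intros)
  qed
  have t_mem1: "t k \<in> mixed_space p q \<phi>" for k using t_mem[of 1 k] by simp
  have S_lin: "linear_operator (mixed_space p q \<phi>) (bloch_space \<mu>) S"
    using S by (simp add: compact_operator_def)
  have S_add: "S (\<lambda>u. f u + h u) = (\<lambda>u. S f u + S h u)" if "f \<in> mixed_space p q \<phi>" "h \<in> mixed_space p q \<phi>" for f h
    by (rule S_lin[unfolded linear_operator_def, THEN conjunct2, THEN conjunct1, rule_format, OF that])
  have S_cmult: "S (\<lambda>u. v * f u) = (\<lambda>u. v * S f u)" if "f \<in> mixed_space p q \<phi>" for f v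
    by (rule S_lin[unfolded linear_operator_def, THEN conjunct2, THEN conjunct2, rule_format, OF that])
  have S_mem: "S f \<in> bloch_space \<mu>" if "f \<in> mixed_space p q \<phi>" for f
    using S_lin that by (auto simp: linear_operator_def)
  have S_cpt: "compactin M.mtopology (M.mtopology closure_of (S ` B))"
    if "B \<subseteq> mixed_space p q \<phi>" "\<forall>f\<in>B. mixed_norm p q \<phi> f \<le> ennreal K" for B K
    by (rule conjunct2[OF S[unfolded compact_operator_def norm_topology_def], rule_format, OF that(1)])
      (rule bspec[OF that(2)])
  have "compactin M.mtopology (M.mtopology closure_of (S ` range t))"
    by (rule S_cpt[of _ "cmod c * 2 powr gap * profile_norm"]) (use t_mem1 t_norm in auto)
  moreover have "range (\<lambda>k. S (t k)) \<subseteq> M.mtopology closure_of (S ` range t)"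
    using closure_of_subset[of "S ` range t" M.mtopology] S_mem t_mem1 by auto
  ultimately have "\<exists>l' s. l' \<in> M.mtopology closure_of (S ` range t) \<and> strict_mono (s :: nat \<Rightarrow> nat) \<and>
      limitin M.mtopology ((\<lambda>k. S (t k)) \<circ> s) l' sequentially"
    by (simp only: M.compactin_sequentially)
  then obtain l' s where s: "strict_mono (s :: nat \<Rightarrow> nat)"
    and lim: "limitin M.mtopology ((\<lambda>k. S (t k)) \<circ> s) l' sequentially"
    by (elim exE conjE) (rule that)
  have l': "l' \<in> bloch_space \<mu>" using lim by (simp add: M.limitin_metric)
  have "0 < e / 4" using e by simp
  with lim have "\<forall>\<^sub>F k in sequentially. ((\<lambda>k. S (t k)) \<circ> s) k \<in> bloch_space \<mu> \<and>
      enn2real (bloch_norm \<mu> (\<lambda>z. ((\<lambda>k. S (t k)) \<circ> s) k z - l' z)) < e / 4"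
    unfolding M.limitin_metric by (elim conjE allE impE)
  then obtain k0 where "\<forall>k\<ge>k0. S (t (s k)) \<in> bloch_space \<mu> \<and>
      enn2real (bloch_norm \<mu> (\<lambda>z. S (t (s k)) z - l' z)) < e / 4"
    unfolding eventually_sequentially o_def by (elim exE) (rule that)
  then have k0: "enn2real (bloch_norm \<mu> (\<lambda>z. S (t (s k)) z - l' z)) < e / 4" if "k0 \<le> k" for k
    using that by (elim allE impE conjE)
  define i where "i = s k0"
  \<comment> \<open>Chosen so that the second test function contributes at most
    \<open>G * \<eta> / test_bound \<le> e / 2\<close>. The index \<open>i\<close> is fixed before
    \<open>k\<close>, so pointwise convergence at \<open>w i\<close> is enough.\<close>
  define \<eta> where "\<eta> = e * test_bound / (2 * (G + 1))"
  have \<eta>: "0 < \<eta>" using e G(1) test_bound_pos by (simp add: \<eta>_def)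
  have "(\<lambda>k. (deriv ^^ n) (test_fun (w (s k))) (w i)) \<longlonglongrightarrow> 0"
    using LIMSEQ_subseq_LIMSEQ[OF higher_deriv_test_fun_tendsto[OF w1 wlim w1[of i], of n] s]
    unfolding o_def .
  then have "\<forall>\<^sub>F k in sequentially. dist ((deriv ^^ n) (test_fun (w (s k))) (w i)) 0 < \<eta>"
    using \<eta> by (rule tendstoD)
  then have "\<forall>\<^sub>F k in sequentially. k0 \<le> k \<and> cmod ((deriv ^^ n) (test_fun (w (s k))) (w i)) < \<eta>"
    using eventually_ge_at_top[of k0] by eventually_elim (simp add: dist_norm)
  then obtain k where k: "k0 \<le> k" "cmod ((deriv ^^ n) (test_fun (w (s k))) (w i)) < \<eta>"
    using eventually_happens'[OF sequentially_bot] by blast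
  define j where "j = s k"
  \<comment> \<open>Written as a sum with scalar -1, the form to which the two linearity clauses for
    \<open>S\<close> apply.\<close>
  define f where "f = (\<lambda>u. t i u + (- 1) * t j u)"
  have f_eq: "f = (\<lambda>u. c * (test_fun (w i) u - test_fun (w j) u))"
    by (auto simp: f_def t_def algebra_simps)
  have f_norm: "mixed_norm p q \<phi> f \<le> 1"
    unfolding f_eq using mixed_norm_test_fun_diff[OF w1 w1, of c i j] test_bound_pos by (simp add: c)
  have f_holo: "f holomorphic_on disc" unfolding f_def by (intro holomorphic_intros t_holo)
  have f_mem: "f \<in> mixed_space p q \<phi>"
  proof -
    have "mixed_norm p q \<phi> f < \<infinity>" using order_le_less_trans[OF f_norm] by simp
    moreover have "f \<in> holo_disc" using f_holo by (simp add: holo_disc_def f_eq test_fun_def)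
    ultimately show ?thesis by (simp add: mixed_space_def)
  qed
  have "S f = (\<lambda>u. S (t i) u + S (\<lambda>u. (- 1) * t j u) u)"
    unfolding f_def by (rule S_add[OF t_mem1 t_mem])
  also have "S (\<lambda>u. (- 1) * t j u) = (\<lambda>u. (- 1) * S (t j) u)"
    by (rule S_cmult[OF t_mem1])
  finally have Sf: "S f = (\<lambda>u. S (t i) u - S (t j) u)" by simp
  have "enn2real (bloch_norm \<mu> (\<lambda>u. S (t i) u - S (t j) u)) < e / 2"
  proof -
    have "enn2real (bloch_norm \<mu> (\<lambda>u. S (t i) u - S (t j) u))
        \<le> enn2real (bloch_norm \<mu> (\<lambda>u. S (t i) u - l' u)) + enn2real (bloch_norm \<mu> (\<lambda>u. S (t j) u - l' u))"
      by (rule M.triangle'[OF S_mem[OF t_mem1] l' S_mem[OF t_mem1]])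
    then show ?thesis using k0[of k0] k0[OF k(1)] by (simp add: i_def j_def)
  qed
  moreover have "bloch_norm \<mu> (S f) < \<infinity>" using S_mem[OF f_mem] by (simp add: bloch_space_def)
  \<comment> \<open>The real-valued bound carries over to \<open>ennreal\<close> because the norm is
    finite; \<open>enn2real\<close> alone could hide an infinite value.\<close>
  ultimately have Sf_norm: "bloch_norm \<mu> (S f) \<le> ennreal (e / 2)"
    unfolding Sf by (cases "bloch_norm \<mu> (\<lambda>u. S (t i) u - S (t j) u)") (auto intro!: ennreal_leI)
  have Tf_mem: "?T f \<in> bloch_space \<mu>"
    using bounded f_mem by (auto simp: bounded_operator_def linear_operator_def)
  have "bloch_norm \<mu> (?T f) \<le> bloch_norm \<mu> (\<lambda>u. ?T f u - S f u) + bloch_norm \<mu> (S f)"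
    using bloch_norm_triangle[OF weight, of "\<lambda>u. ?T f u - S f u" "S f"] Tf_mem S_mem[OF f_mem]
    by (auto simp: bloch_space_def holo_disc_def intro!: holomorphic_intros)
  also have "\<dots> \<le> ?N + ennreal (e / 2)"
    unfolding op_norm_def using f_mem f_norm by (intro add_mono SUP_upper2[of f] Sf_norm) auto
  finally have T_upper: "bloch_norm \<mu> (?T f) \<le> ?N + ennreal (e / 2)" .
  let ?m = "\<mu> (of_real (cmod (z i))) * cmod (g (z i))"
  let ?di = "cmod ((deriv ^^ n) (test_fun (w i)) (w i))" and ?dj = "cmod ((deriv ^^ n) (test_fun (w j)) (w i))"
  have m0: "0 \<le> ?m" using \<mu>_pos[OF z(1)[of i]] by simp
  have "(deriv ^^ n) f (w i) = c * ((deriv ^^ n) (test_fun (w i)) (w i) - (deriv ^^ n) (test_fun (w j)) (w i))"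
  proof -
    have th: "test_fun (w k) holomorphic_on disc" for k
      using test_fun_holo_disc[OF w1, of k] by (simp add: holo_disc_def)
    have "(deriv ^^ n) f (w i) = c * (deriv ^^ n) (\<lambda>u. test_fun (w i) u - test_fun (w j) u) (w i)"
      unfolding f_eq using w1 by (intro higher_deriv_cmult[of _ disc] holomorphic_intros th) auto
    also have "(deriv ^^ n) (\<lambda>u. test_fun (w i) u - test_fun (w j) u) (w i)
        = (deriv ^^ n) (test_fun (w i)) (w i) - (deriv ^^ n) (test_fun (w j)) (w i)"
      using w1 by (intro higher_deriv_diff[of _ disc] th) auto
    finally show ?thesis .
  qed
  then have "(?di - ?dj) / test_bound \<le> cmod ((deriv ^^ n) f (w i))"
    using norm_triangle_ineq2[of "(deriv ^^ n) (test_fun (w i)) (w i)" "(deriv ^^ n) (test_fun (w j)) (w i)"]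
      test_bound_pos by (simp add: norm_mult c divide_right_mono)
  then have "?m * ((?di - ?dj) / test_bound) \<le> ?m * cmod ((deriv ^^ n) f (w i))"
    using m0 by (rule mult_left_mono)
  moreover have "?m * cmod ((deriv ^^ n) f (w i)) = \<mu> (of_real (cmod (z i))) * cmod (deriv (?T f) (z i))"
    using DERIV_imp_deriv[OF integration_operator_has_deriv[OF f_holo z(1), of n i]]
    by (simp add: w_def norm_mult)
  moreover have "lower_const * l \<le> ?m * ?di / test_bound"
  proof -
    have "l * (1 / 2) ^ n \<le> ratio (z i) * (1 / 2) ^ n"
      using z(3)[of i] by (intro mult_right_mono) auto
    also have "\<dots> = ?m * ((1 / 2) ^ n / growth n (cmod (w i)))"
      by (simp add: ratio_def w_def)
    also have "\<dots> \<le> ?m * ?di"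
      using m0 by (intro mult_left_mono higher_deriv_test_fun_lower w1 w2)
    finally show ?thesis
      using test_bound_pos by (simp add: lower_const_def divide_right_mono mult.commute)
  qed
  moreover have "?m * ?dj / test_bound \<le> e / 2"
  proof -
    have "?m * ?dj \<le> G * \<eta>"
      using G(1) G(2)[OF z(1)[of i]] k(2) m0 by (intro mult_mono) (auto simp: j_def)
    also have "\<dots> = e * test_bound / 2 * (G / (G + 1))" by (simp add: \<eta>_def)
    also have "\<dots> \<le> e * test_bound / 2"
      using e test_bound_pos G(1) by (intro mult_left_le) auto
    finally show ?thesis using test_bound_pos by (simp add: divide_le_eq mult.commute)
  qed
  ultimately have "lower_const * l \<le> \<mu> (of_real (cmod (z i))) * cmod (deriv (?T f) (z i)) + e / 2"
    by (simp add: right_diff_distrib diff_divide_distrib)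
  then have "ennreal (lower_const * l) \<le> ennreal (\<mu> (of_real (cmod (z i))) * cmod (deriv (?T f) (z i)) + e / 2)"
    by (rule ennreal_leI)
  also have "\<dots> = ennreal (\<mu> (of_real (cmod (z i))) * cmod (deriv (?T f) (z i))) + ennreal (e / 2)"
    using \<mu>_pos[OF z(1)[of i]] e by (intro ennreal_plus) auto
  also have "\<dots> \<le> bloch_norm \<mu> (?T f) + ennreal (e / 2)"
    by (intro add_right_mono bloch_norm_ge z)
  also have "\<dots> \<le> (?N + ennreal (e / 2)) + ennreal (e / 2)"
    by (intro add_right_mono T_upper)
  also have "\<dots> = ?N + ennreal e"
    using e by (simp add: add.assoc flip: ennreal_plus)
  finally show "ennreal (lower_const * l) \<le> ?N + ennreal e" .
qed

lemma essential_norm_lower: "ennreal lower_const * boundary_limsup \<psi> ratio \<le> ess"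
  unfolding essential_norm_def
proof (rule INF_greatest)
  fix S assume "S \<in> {S. compact_operator (mixed_space p q \<phi>) (mixed_norm p q \<phi>) (bloch_space \<mu>) (bloch_norm \<mu>) S}"
  then have S: "compact_operator (mixed_space p q \<phi>) (mixed_norm p q \<phi>) (bloch_space \<mu>) (bloch_norm \<mu>) S" by simp
  let ?N = "op_norm (mixed_space p q \<phi>) (mixed_norm p q \<phi>) (bloch_norm \<mu>) (\<lambda>f z. integration_operator n \<psi> g f z - S f z)"
  have "boundary_limsup \<psi> ratio \<le> ennreal (1 / lower_const) * ?N"
  \<comment> \<open>The limsup is not known to be finite at this point, so it is approached from
    below by real numbers \<open>l\<close>.\<close>
  proof (rule dense_le)
    fix x assume x: "x < boundary_limsup \<psi> ratio"
    then obtain l where l: "0 \<le> l" "x = ennreal l" by (cases x) auto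
    have "ennreal l = ennreal (1 / lower_const) * ennreal (lower_const * l)"
      using lower_const_pos l by (simp add: ennreal_mult[symmetric])
    also have "\<dots> \<le> ennreal (1 / lower_const) * ?N"
      using op_norm_compact_perturbation_lower[OF S l(1)] x l by (intro mult_left_mono) auto
    finally show "x \<le> ennreal (1 / lower_const) * ?N" using l by simp
  qed
  then have "ennreal lower_const * boundary_limsup \<psi> ratio \<le> ennreal lower_const * (ennreal (1 / lower_const) * ?N)"
    by (intro mult_left_mono) auto
  also have "\<dots> = ?N"
    using lower_const_pos by (simp add: ennreal_mult[symmetric] flip: mult.assoc)
  finally show "ennreal lower_const * boundary_limsup \<psi> ratio \<le> ?N" .
qed

end

theorem theorem2p7:
  fixes p q :: real and \<phi> :: "real \<Rightarrow> real" and n :: nat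
  assumes "0 < p" and "0 < q" and "normal_function \<phi>"
  shows "\<exists>C1 C2 :: real. 0 < C1 \<and> 0 < C2 \<and>
    (\<forall>\<mu> g \<psi>. weight \<mu> \<longrightarrow> g holomorphic_on disc \<longrightarrow> self_map \<psi> \<longrightarrow>
      bounded_operator (mixed_space p q \<phi>) (mixed_norm p q \<phi>) (bloch_space \<mu>) (bloch_norm \<mu>)
        (integration_operator n \<psi> g) \<longrightarrow>
      (let E = essential_norm (mixed_space p q \<phi>) (mixed_norm p q \<phi>) (bloch_space \<mu>) (bloch_norm \<mu>)
                 (integration_operator n \<psi> g);
           L = boundary_limsup \<psi> (\<lambda>z. \<mu> (of_real (cmod z)) * cmod (g z) /
                 (\<phi> (cmod (\<psi> z)) * (1 - (cmod (\<psi> z))\<^sup>2) powr (1 / q + real n)))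
       in ennreal C1 * L \<le> E \<and> E \<le> ennreal C2 * L))"
proof -
  obtain a b where setting: "mixed_norm_setting p q a b \<phi>"
    using mixed_norm_setting_of_normal_function[OF assms] .
  interpret mixed_norm_setting p q a b \<phi> by (rule setting)
  show ?thesis
  \<comment> \<open>The witnesses are terms of the setting without \<open>\<mu>\<close>,
    \<open>g\<close> and \<open>\<psi>\<close>; \<open>lower_const\<close> belongs to a locale that
    fixes these and is therefore written out.\<close>
  proof (rule exI[of _ "(1 / 2) ^ n / test_bound"], rule exI[of _ "2 * upper_const n"], intro conjI allI impI)
    show "0 < (1 / 2) ^ n / test_bound" using test_bound_pos by simp
    show "0 < 2 * upper_const n" using upper_const_pos by simp
    fix \<mu> :: "complex \<Rightarrow> real" and g \<psi> :: "complex \<Rightarrow> complex"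
    assume "weight \<mu>" "g holomorphic_on disc" "self_map \<psi>"
      and "bounded_operator (mixed_space p q \<phi>) (mixed_norm p q \<phi>) (bloch_space \<mu>) (bloch_norm \<mu>)
        (integration_operator n \<psi> g)"
    then interpret bounded_integration_setting p q a b \<phi> \<mu> g \<psi> n
      by unfold_locales
    show "let E = essential_norm (mixed_space p q \<phi>) (mixed_norm p q \<phi>) (bloch_space \<mu>) (bloch_norm \<mu>)
                 (integration_operator n \<psi> g);
           L = boundary_limsup \<psi> (\<lambda>z. \<mu> (of_real (cmod z)) * cmod (g z) /
                 (\<phi> (cmod (\<psi> z)) * (1 - (cmod (\<psi> z))\<^sup>2) powr (1 / q + real n)))
       in ennreal ((1 / 2) ^ n / test_bound) * L \<le> E \<and> E \<le> ennreal (2 * upper_const n) * L"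
      using essential_norm_lower essential_norm_upper
      unfolding lower_const_def ratio_def[abs_def] growth_def Let_def by blast
  qed
qed

end
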